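(* Let $\underline{\mathcal C}=(\mathcal C_\alpha)_{\alpha\in G}$ be a $G$-$A$-coring. There is a bijective correspondence between - grouplike families of $\underline{\mathcal C}$; - right $\underline{\mathcal C}$-comodule structures on $A$.
   Context: $G$ is a group with unit $e$, $A$ is a ring with unit. A $G$-$A$-coring (group coring) $\underline{\mathcal C}$ is a family $(\mathcal C_\alpha)_{\alpha\in G}$ of $A$-bimodules with $A$-bimodule maps $\Delta_{\alpha,\beta}:\mathcal C_{\alpha\beta}\to\mathcal C_\alpha\otimes_A\mathcal C_\beta$ and $\varepsilon:\mathcal C_e\to A$ such that, for all $\alpha,\beta,\gamma\in G$, $(\Delta_{\alpha,\beta}\otimes_A\mathcal C_\gamma)\circ\Delta_{\alpha\beta,\gamma}=(\mathcal C_\alpha\otimes_A\Delta_{\beta,\gamma})\circ\Delta_{\alpha,\beta\gamma}$ and $(\mathcal C_\alpha\otimes_A\varepsilon)\circ\Delta_{\alpha,e}=\mathcal C_\alpha=(\varepsilon\otimes_A\mathcal C_\alpha)\circ\Delta_{e,\alpha}$ (an object also denotes its identity map). A family $\underline x=(x_\alpha)_{\alpha\in G}\in\prod_{\alpha\in G}\mathcal C_\alpha$ is called grouplike if $\Delta_{\alpha,\beta}(x_{\alpha\beta})=x_\alpha\otimes_Ax_\beta$ for all $\alpha,\beta\in G$ and $\varepsilon(x_e)=1$. A right $\underline{\mathcal C}$-comodule is a right $A$-module $M$ together with a family of right $A$-linear maps $\rho_\alpha:M\to M\otimes_A\mathcal C_\alpha$ ($\alpha\in G$) such that $(M\otimes_A\Delta_{\alpha,\beta})\circ\rho_{\alpha\beta}=(\rho_\alpha\otimes_A\mathcal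 C_\beta)\circ\rho_\beta$ for all $\alpha,\beta\in G$ and $(M\otimes_A\varepsilon)\circ\rho_e=M$. A right $\underline{\mathcal C}$-comodule structure on $A$ is such a family of maps for $M=A$, regarded as a right $A$-module via multiplication. *)

theory Defs
  imports "HOL-Algebra.Algebra"
begin

section \<open>Modules over a ring that need not be commutative\<close>

text \<open>As in \<^theory>\<open>HOL-Algebra.Module\<close>, only the additive part of the underlying ring record
  is relevant for modules. A bimodule record is also a right module record.\<close>

record ('a, 'm) right_module = "'m ring" +
  rsmult :: "'m \<Rightarrow> 'a \<Rightarrow> 'm" (infixl "\<triangleleft>\<index>" 70)

record ('a, 'm) bimodule = "('a, 'm) right_module" +
  lsmult :: "'a \<Rightarrow> 'm \<Rightarrow> 'm" (infixr "\<triangleright>\<index>" 70)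

locale right_module = R?: ring R + M?: abelian_group M
  for R :: "('a, 'r) ring_scheme" (structure)
    and M :: "('a, 'm, 'x) right_module_scheme" (structure) +
  assumes rsmult_closed: "\<lbrakk>m \<in> carrier M; a \<in> carrier R\<rbrakk> \<Longrightarrow> m \<triangleleft>\<^bsub>M\<^esub> a \<in> carrier M"
    and rsmult_l_distr: "\<lbrakk>m \<in> carrier M; n \<in> carrier M; a \<in> carrier R\<rbrakk> \<Longrightarrow>
      (m \<oplus>\<^bsub>M\<^esub> n) \<triangleleft>\<^bsub>M\<^esub> a = m \<triangleleft>\<^bsub>M\<^esub> a \<oplus>\<^bsub>M\<^esub> n \<triangleleft>\<^bsub>M\<^esub> a"
    and rsmult_r_distr: "\<lbrakk>m \<in> carrier M; a \<in> carrier R; b \<in> carrier R\<rbrakk> \<Longrightarrow>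
      m \<triangleleft>\<^bsub>M\<^esub> (a \<oplus>\<^bsub>R\<^esub> b) = m \<triangleleft>\<^bsub>M\<^esub> a \<oplus>\<^bsub>M\<^esub> m \<triangleleft>\<^bsub>M\<^esub> b"
    and rsmult_assoc: "\<lbrakk>m \<in> carrier M; a \<in> carrier R; b \<in> carrier R\<rbrakk> \<Longrightarrow>
      m \<triangleleft>\<^bsub>M\<^esub> (a \<otimes>\<^bsub>R\<^esub> b) = (m \<triangleleft>\<^bsub>M\<^esub> a) \<triangleleft>\<^bsub>M\<^esub> b"
    and rsmult_one: "m \<in> carrier M \<Longrightarrow> m \<triangleleft>\<^bsub>M\<^esub> \<one>\<^bsub>R\<^esub> = m"

locale bimodule = right_module R M
  for R :: "('a, 'r) ring_scheme" (structure)
    and M :: "('a, 'm, 'x) bimodule_scheme" (structure) +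
  assumes lsmult_closed: "\<lbrakk>a \<in> carrier R; m \<in> carrier M\<rbrakk> \<Longrightarrow> a \<triangleright>\<^bsub>M\<^esub> m \<in> carrier M"
    and lsmult_r_distr: "\<lbrakk>a \<in> carrier R; m \<in> carrier M; n \<in> carrier M\<rbrakk> \<Longrightarrow>
      a \<triangleright>\<^bsub>M\<^esub> (m \<oplus>\<^bsub>M\<^esub> n) = (a \<triangleright>\<^bsub>M\<^esub> m) \<oplus>\<^bsub>M\<^esub> (a \<triangleright>\<^bsub>M\<^esub> n)"
    and lsmult_l_distr: "\<lbrakk>a \<in> carrier R; b \<in> carrier R; m \<in> carrier M\<rbrakk> \<Longrightarrow>
      (a \<oplus>\<^bsub>R\<^esub> b) \<triangleright>\<^bsub>M\<^esub> m = (a \<triangleright>\<^bsub>M\<^esub> m) \<oplus>\<^bsub>M\<^esub> (b \<triangleright>\<^bsub>M\<^esub> m)"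
    and lsmult_assoc: "\<lbrakk>a \<in> carrier R; b \<in> carrier R; m \<in> carrier M\<rbrakk> \<Longrightarrow>
      (a \<otimes>\<^bsub>R\<^esub> b) \<triangleright>\<^bsub>M\<^esub> m = a \<triangleright>\<^bsub>M\<^esub> (b \<triangleright>\<^bsub>M\<^esub> m)"
    and lsmult_one: "m \<in> carrier M \<Longrightarrow> \<one>\<^bsub>R\<^esub> \<triangleright>\<^bsub>M\<^esub> m = m"
    and lsmult_rsmult: "\<lbrakk>a \<in> carrier R; m \<in> carrier M; b \<in> carrier R\<rbrakk> \<Longrightarrow>
      (a \<triangleright>\<^bsub>M\<^esub> m) \<triangleleft>\<^bsub>M\<^esub> b = a \<triangleright>\<^bsub>M\<^esub> (m \<triangleleft>\<^bsub>M\<^esub> b)"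

definition right_module_hom ::
    "('a, 'r) ring_scheme \<Rightarrow> ('a, 'm, 'x) right_module_scheme \<Rightarrow>
      ('a, 'n, 'y) right_module_scheme \<Rightarrow> ('m \<Rightarrow> 'n) set" where
  "right_module_hom R M N = {f \<in> carrier M \<rightarrow> carrier N.
     (\<forall>m\<in>carrier M. \<forall>n\<in>carrier M. f (m \<oplus>\<^bsub>M\<^esub> n) = f m \<oplus>\<^bsub>N\<^esub> f n) \<and>
     (\<forall>m\<in>carrier M. \<forall>a\<in>carrier R. f (m \<triangleleft>\<^bsub>M\<^esub> a) = f m \<triangleleft>\<^bsub>N\<^esub> a)}"

definition bimodule_hom ::
    "('a, 'r) ring_scheme \<Rightarrow> ('a, 'm, 'x) bimodule_scheme \<Rightarrow>
      ('a, 'n, 'y) bimodule_scheme \<Rightarrow> ('m \<Rightarrow> 'n) set" where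
  "bimodule_hom R M N = {f \<in> right_module_hom R M N.
     \<forall>a\<in>carrier R. \<forall>m\<in>carrier M. f (a \<triangleright>\<^bsub>M\<^esub> m) = a \<triangleright>\<^bsub>N\<^esub> f m}"

definition regular_bimodule :: "('a, 'r) ring_scheme \<Rightarrow> ('a, 'a) bimodule" where
  "regular_bimodule R =
     \<lparr>carrier = carrier R, monoid.mult = monoid.mult R, one = \<one>\<^bsub>R\<^esub>, ring.zero = \<zero>\<^bsub>R\<^esub>, add = add R,
      rsmult = monoid.mult R, lsmult = monoid.mult R\<rparr>"


section \<open>Tensor products over a ring\<close>

text \<open>\<open>M \<otimes>\<^sub>R N\<close> is the free abelian group on \<open>M \<times> N\<close> modulo the usual relations; the library
  writes this quotient group multiplicatively. The right factor is always a bimodule here.\<close>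

definition tensor_relations ::
    "('a, 'r) ring_scheme \<Rightarrow> ('a, 'm, 'x) right_module_scheme \<Rightarrow>
      ('a, 'n, 'y) bimodule_scheme \<Rightarrow> ('m \<times> 'n \<Rightarrow>\<^sub>0 int) set" where
  "tensor_relations R M N =
     {frag_of (m \<oplus>\<^bsub>M\<^esub> m', n) - frag_of (m, n) - frag_of (m', n) | m m' n.
        m \<in> carrier M \<and> m' \<in> carrier M \<and> n \<in> carrier N} \<union>
     {frag_of (m, n \<oplus>\<^bsub>N\<^esub> n') - frag_of (m, n) - frag_of (m, n') | m n n'.
        m \<in> carrier M \<and> n \<in> carrier N \<and> n' \<in> carrier N} \<union>
     {frag_of (m \<triangleleft>\<^bsub>M\<^esub> a, n) - frag_of (m, a \<triangleright>\<^bsub>N\<^esub> n) | m a n.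
        m \<in> carrier M \<and> a \<in> carrier R \<and> n \<in> carrier N}"

definition tensor_kernel ::
    "('a, 'r) ring_scheme \<Rightarrow> ('a, 'm, 'x) right_module_scheme \<Rightarrow>
      ('a, 'n, 'y) bimodule_scheme \<Rightarrow> ('m \<times> 'n \<Rightarrow>\<^sub>0 int) set" where
  "tensor_kernel R M N =
     generate (free_Abelian_group (carrier M \<times> carrier N)) (tensor_relations R M N)"

definition tensor_group ::
    "('a, 'r) ring_scheme \<Rightarrow> ('a, 'm, 'x) right_module_scheme \<Rightarrow>
      ('a, 'n, 'y) bimodule_scheme \<Rightarrow> ('m \<times> 'n \<Rightarrow>\<^sub>0 int) set ring" where
  "tensor_group R M N =
     (let Q = free_Abelian_group (carrier M \<times> carrier N) Mod tensor_kernel R M N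
      in \<lparr>carrier = carrier Q, monoid.mult = undefined, one = undefined,
          ring.zero = \<one>\<^bsub>Q\<^esub>, add = monoid.mult Q\<rparr>)"

definition pure_tensor ::
    "('a, 'r) ring_scheme \<Rightarrow> ('a, 'm, 'x) right_module_scheme \<Rightarrow>
      ('a, 'n, 'y) bimodule_scheme \<Rightarrow> 'm \<Rightarrow> 'n \<Rightarrow> ('m \<times> 'n \<Rightarrow>\<^sub>0 int) set" where
  "pure_tensor R M N m n =
     tensor_kernel R M N #>\<^bsub>free_Abelian_group (carrier M \<times> carrier N)\<^esub> frag_of (m, n)"

text \<open>The additive map out of a tensor product sending each \<open>m \<otimes> n\<close> to \<open>b m n\<close>, for \<open>b\<close> an
  \<open>R\<close>-balanced biadditive map into \<open>P\<close>: the linear extension of \<open>b\<close> to the free abelian group is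
  constant on cosets, and \<^const>\<open>the_elem\<close> extracts its value.\<close>

definition tensor_lift ::
    "('p, 'z) ring_scheme \<Rightarrow> ('m \<Rightarrow> 'n \<Rightarrow> 'p) \<Rightarrow> ('m \<times> 'n \<Rightarrow>\<^sub>0 int) set \<Rightarrow> 'p" where
  "tensor_lift P b t = the_elem
     ((\<lambda>c. \<Oplus>\<^bsub>P\<^esub>p\<in>Poly_Mapping.keys c. [Poly_Mapping.lookup c p] \<cdot>\<^bsub>P\<^esub> b (fst p) (snd p)) ` t)"

definition tensor_right_module ::
    "('a, 'r) ring_scheme \<Rightarrow> ('a, 'm, 'x) right_module_scheme \<Rightarrow>
      ('a, 'n, 'y) bimodule_scheme \<Rightarrow> ('a, ('m \<times> 'n \<Rightarrow>\<^sub>0 int) set) right_module" where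
  "tensor_right_module R M N = ring.extend (tensor_group R M N)
     (right_module.fields
        (\<lambda>t a. tensor_lift (tensor_group R M N) (\<lambda>m n. pure_tensor R M N m (n \<triangleleft>\<^bsub>N\<^esub> a)) t))"

definition tensor_bimodule ::
    "('a, 'r) ring_scheme \<Rightarrow> ('a, 'm, 'x) bimodule_scheme \<Rightarrow>
      ('a, 'n, 'y) bimodule_scheme \<Rightarrow> ('a, ('m \<times> 'n \<Rightarrow>\<^sub>0 int) set) bimodule" where
  "tensor_bimodule R M N = right_module.extend (tensor_right_module R M N)
     (bimodule.fields
        (\<lambda>a t. tensor_lift (tensor_group R M N) (\<lambda>m n. pure_tensor R M N (a \<triangleright>\<^bsub>M\<^esub> m) n) t))"

text \<open>\<open>f \<otimes> g\<close>, where \<open>M\<close> and \<open>N\<close> are the codomains of \<open>f\<close> and \<open>g\<close>.\<close>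

definition tensor_map ::
    "('a, 'r) ring_scheme \<Rightarrow> ('a, 'm, 'x) right_module_scheme \<Rightarrow> ('a, 'n, 'y) bimodule_scheme \<Rightarrow>
      ('k \<Rightarrow> 'm) \<Rightarrow> ('l \<Rightarrow> 'n) \<Rightarrow> ('k \<times> 'l \<Rightarrow>\<^sub>0 int) set \<Rightarrow> ('m \<times> 'n \<Rightarrow>\<^sub>0 int) set" where
  "tensor_map R M N f g =
     tensor_lift (tensor_group R M N) (\<lambda>k l. pure_tensor R M N (f k) (g l))"

text \<open>The canonical isomorphisms \<open>(M \<otimes> N) \<otimes> P \<rightarrow> M \<otimes> (N \<otimes> P)\<close>, \<open>M \<otimes> R \<rightarrow> M\<close> and
  \<open>R \<otimes> M \<rightarrow> M\<close>, which are usually suppressed.\<close>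

definition tensor_assoc ::
    "('a, 'r) ring_scheme \<Rightarrow> ('a, 'm, 'x) right_module_scheme \<Rightarrow> ('a, 'n, 'y) bimodule_scheme \<Rightarrow>
      ('a, 'p, 'z) bimodule_scheme \<Rightarrow> (('m \<times> 'n \<Rightarrow>\<^sub>0 int) set \<times> 'p \<Rightarrow>\<^sub>0 int) set \<Rightarrow>
      ('m \<times> ('n \<times> 'p \<Rightarrow>\<^sub>0 int) set \<Rightarrow>\<^sub>0 int) set" where
  "tensor_assoc R M N P =
     (let NP = tensor_bimodule R N P; T = tensor_group R M NP
      in tensor_lift T (\<lambda>t p.
           tensor_lift T (\<lambda>m n. pure_tensor R M NP m (pure_tensor R N P n p)) t))"

definition tensor_right_unit ::
    "('a, 'm, 'x) right_module_scheme \<Rightarrow> ('m \<times> 'a \<Rightarrow>\<^sub>0 int) set \<Rightarrow> 'm" where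
  "tensor_right_unit M = tensor_lift M (\<lambda>m a. m \<triangleleft>\<^bsub>M\<^esub> a)"

definition tensor_left_unit ::
    "('a, 'm, 'x) bimodule_scheme \<Rightarrow> ('a \<times> 'm \<Rightarrow>\<^sub>0 int) set \<Rightarrow> 'm" where
  "tensor_left_unit M = tensor_lift M (\<lambda>a m. a \<triangleright>\<^bsub>M\<^esub> m)"


section \<open>Group corings, grouplike families and comodules\<close>

locale group_coring =
  fixes G :: "('g, 'h) monoid_scheme"
    and A :: "('a, 'r) ring_scheme"
    and C :: "'g \<Rightarrow> ('a, 'c) bimodule"
    and \<Delta> :: "'g \<Rightarrow> 'g \<Rightarrow> 'c \<Rightarrow> ('c \<times> 'c \<Rightarrow>\<^sub>0 int) set"
    and \<epsilon> :: "'c \<Rightarrow> 'a"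
  assumes group: "group G"
    and ring: "ring A"
    and bimodule: "\<alpha> \<in> carrier G \<Longrightarrow> bimodule A (C \<alpha>)"
    and comult_hom: "\<lbrakk>\<alpha> \<in> carrier G; \<beta> \<in> carrier G\<rbrakk> \<Longrightarrow>
      \<Delta> \<alpha> \<beta> \<in> bimodule_hom A (C (\<alpha> \<otimes>\<^bsub>G\<^esub> \<beta>)) (tensor_bimodule A (C \<alpha>) (C \<beta>))"
    and counit_hom: "\<epsilon> \<in> bimodule_hom A (C \<one>\<^bsub>G\<^esub>) (regular_bimodule A)"
    and coassoc: "\<lbrakk>\<alpha> \<in> carrier G; \<beta> \<in> carrier G; \<gamma> \<in> carrier G;
        c \<in> carrier (C (\<alpha> \<otimes>\<^bsub>G\<^esub> \<beta> \<otimes>\<^bsub>G\<^esub> \<gamma>))\<rbrakk> \<Longrightarrow>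
      tensor_assoc A (C \<alpha>) (C \<beta>) (C \<gamma>)
        (tensor_map A (tensor_bimodule A (C \<alpha>) (C \<beta>)) (C \<gamma>) (\<Delta> \<alpha> \<beta>) id
          (\<Delta> (\<alpha> \<otimes>\<^bsub>G\<^esub> \<beta>) \<gamma> c)) =
      tensor_map A (C \<alpha>) (tensor_bimodule A (C \<beta>) (C \<gamma>)) id (\<Delta> \<beta> \<gamma>)
        (\<Delta> \<alpha> (\<beta> \<otimes>\<^bsub>G\<^esub> \<gamma>) c)"
    and counit_right: "\<lbrakk>\<alpha> \<in> carrier G; c \<in> carrier (C \<alpha>)\<rbrakk> \<Longrightarrow>
      tensor_right_unit (C \<alpha>)
        (tensor_map A (C \<alpha>) (regular_bimodule A) id \<epsilon> (\<Delta> \<alpha> \<one>\<^bsub>G\<^esub> c)) = c"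
    and counit_left: "\<lbrakk>\<alpha> \<in> carrier G; c \<in> carrier (C \<alpha>)\<rbrakk> \<Longrightarrow>
      tensor_left_unit (C \<alpha>)
        (tensor_map A (regular_bimodule A) (C \<alpha>) \<epsilon> id (\<Delta> \<one>\<^bsub>G\<^esub> \<alpha> c)) = c"

text \<open>Families are taken extensional, so that equality of functions in HOL is equality of
  families indexed by the carrier of \<open>G\<close>; likewise for comodule structures below.\<close>

definition grouplike_families ::
    "('g, 'h) monoid_scheme \<Rightarrow> ('a, 'r) ring_scheme \<Rightarrow> ('g \<Rightarrow> ('a, 'c) bimodule) \<Rightarrow>
      ('g \<Rightarrow> 'g \<Rightarrow> 'c \<Rightarrow> ('c \<times> 'c \<Rightarrow>\<^sub>0 int) set) \<Rightarrow> ('c \<Rightarrow> 'a) \<Rightarrow> ('g \<Rightarrow> 'c) set" where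
  "grouplike_families G A C \<Delta> \<epsilon> = {x \<in> (\<Pi>\<^sub>E \<alpha>\<in>carrier G. carrier (C \<alpha>)).
     (\<forall>\<alpha>\<in>carrier G. \<forall>\<beta>\<in>carrier G.
        \<Delta> \<alpha> \<beta> (x (\<alpha> \<otimes>\<^bsub>G\<^esub> \<beta>)) = pure_tensor A (C \<alpha>) (C \<beta>) (x \<alpha>) (x \<beta>)) \<and>
     \<epsilon> (x \<one>\<^bsub>G\<^esub>) = \<one>\<^bsub>A\<^esub>}"

locale right_comodule = group_coring G A C \<Delta> \<epsilon> + right_module A M
  for G :: "('g, 'h) monoid_scheme"
    and A :: "('a, 'r) ring_scheme"
    and C :: "'g \<Rightarrow> ('a, 'c) bimodule"
    and \<Delta> :: "'g \<Rightarrow> 'g \<Rightarrow> 'c \<Rightarrow> ('c \<times> 'c \<Rightarrow>\<^sub>0 int) set"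
    and \<epsilon> :: "'c \<Rightarrow> 'a"
    and M :: "('a, 'm, 'x) right_module_scheme" +
  fixes \<rho> :: "'g \<Rightarrow> 'm \<Rightarrow> ('m \<times> 'c \<Rightarrow>\<^sub>0 int) set"
  assumes coaction_hom: "\<alpha> \<in> carrier G \<Longrightarrow>
      \<rho> \<alpha> \<in> right_module_hom A M (tensor_right_module A M (C \<alpha>))"
    and coaction_coassoc: "\<lbrakk>\<alpha> \<in> carrier G; \<beta> \<in> carrier G; m \<in> carrier M\<rbrakk> \<Longrightarrow>
      tensor_map A M (tensor_bimodule A (C \<alpha>) (C \<beta>)) id (\<Delta> \<alpha> \<beta>) (\<rho> (\<alpha> \<otimes>\<^bsub>G\<^esub> \<beta>) m) =
      tensor_assoc A M (C \<alpha>) (C \<beta>)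
        (tensor_map A (tensor_right_module A M (C \<alpha>)) (C \<beta>) (\<rho> \<alpha>) id (\<rho> \<beta> m))"
    and coaction_counit: "m \<in> carrier M \<Longrightarrow>
      tensor_right_unit M (tensor_map A M (regular_bimodule A) id \<epsilon> (\<rho> \<one>\<^bsub>G\<^esub> m)) = m"

definition comodule_structures ::
    "('g, 'h) monoid_scheme \<Rightarrow> ('a, 'r) ring_scheme \<Rightarrow> ('g \<Rightarrow> ('a, 'c) bimodule) \<Rightarrow>
      ('g \<Rightarrow> 'g \<Rightarrow> 'c \<Rightarrow> ('c \<times> 'c \<Rightarrow>\<^sub>0 int) set) \<Rightarrow> ('c \<Rightarrow> 'a) \<Rightarrow>
      ('a, 'm, 'x) right_module_scheme \<Rightarrow> ('g \<Rightarrow> 'm \<Rightarrow> ('m \<times> 'c \<Rightarrow>\<^sub>0 int) set) set" where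
  "comodule_structures G A C \<Delta> \<epsilon> M =
     {\<rho> \<in> (\<Pi>\<^sub>E \<alpha>\<in>carrier G. carrier M \<rightarrow>\<^sub>E carrier (tensor_right_module A M (C \<alpha>))).
        right_comodule G A C \<Delta> \<epsilon> M \<rho>}"

end

theory Submission
  imports Defs
begin

text \<open>The whole correspondence rests on the isomorphism \<open>A \<otimes> N \<cong> N\<close>, \<open>a \<otimes> n \<mapsto> a n\<close>, for a bimodule
  \<open>N\<close>: every element of \<open>A \<otimes> N\<close> is \<open>1 \<otimes> n\<close> for exactly one \<open>n\<close> (\<open>pure_one_tensor_left_unit\<close>,
  \<open>pure_one_inj\<close>). A right \<open>A\<close>-linear map \<open>\<rho>\<^sub>\<alpha> : A \<rightarrow> A \<otimes> C\<^sub>\<alpha>\<close> is determined by \<open>\<rho>\<^sub>\<alpha>(1)\<close>, hence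
  by the element \<open>x\<^sub>\<alpha>\<close> with \<open>\<rho>\<^sub>\<alpha>(1) = 1 \<otimes> x\<^sub>\<alpha>\<close>, and then \<open>\<rho>\<^sub>\<alpha>(a) = 1 \<otimes> x\<^sub>\<alpha> a\<close>. Conversely every
  element \<open>x\<^sub>\<alpha>\<close> defines a right linear map in this way.

  Under this dictionary the two sides of the coassociativity law at \<open>1\<close> become
  \<open>1 \<otimes> \<Delta>\<^sub>\<alpha>\<^sub>\<beta>(x\<^sub>\<alpha>\<^sub>\<beta>)\<close> and \<open>1 \<otimes> (x\<^sub>\<alpha> \<otimes> x\<^sub>\<beta>)\<close> (\<open>comult_after_coaction\<close>,
  \<open>coaction_after_coaction\<close>), and the counit law at \<open>1\<close> reads \<open>\<epsilon>(x\<^sub>e) = 1\<close>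
  (\<open>counit_after_coaction\<close>). Applying the isomorphism to \<open>N = C\<^sub>\<alpha> \<otimes> C\<^sub>\<beta>\<close> cancels \<open>1 \<otimes>\<close>, so the
  laws at \<open>1\<close> say precisely that \<open>x\<close> is grouplike; by right linearity they then hold at every \<open>a\<close>.

  All of this is evaluated on pure tensors. The work that remains is to justify such evaluations:
  the map \<open>tensor_lift\<close> induced by a balanced map is additive and has the expected values
  (\<open>tensor_lift_additive\<close>, \<open>tensor_lift_pure\<close>), additive maps that agree on pure tensors are equal
  (\<open>additive_maps_eqI\<close>), and the maps occurring in the definitions of comodule and coring arise
  from balanced maps.\<close>

section \<open>Linear extension to free abelian groups\<close>

definition additive_maps :: "('m, 'x) ring_scheme \<Rightarrow> ('n, 'y) ring_scheme \<Rightarrow> ('m \<Rightarrow> 'n) set" where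
  "additive_maps U V = hom (add_monoid U) (add_monoid V)"

lemma additive_maps_cong:
  assumes "carrier U = carrier U'" "add U = add U'"
  shows "additive_maps U V = additive_maps U' V"
  using assms by (simp add: additive_maps_def hom_def)

lemma additive_mapsI:
  assumes "\<And>x. x \<in> carrier U \<Longrightarrow> f x \<in> carrier V"
    and "\<And>x y. \<lbrakk>x \<in> carrier U; y \<in> carrier U\<rbrakk> \<Longrightarrow> f (x \<oplus>\<^bsub>U\<^esub> y) = f x \<oplus>\<^bsub>V\<^esub> f y"
  shows "f \<in> additive_maps U V"
  using assms by (auto simp: additive_maps_def hom_def)

lemma additive_maps_closed: "\<lbrakk>f \<in> additive_maps U V; x \<in> carrier U\<rbrakk> \<Longrightarrow> f x \<in> carrier V"
  by (auto simp: additive_maps_def hom_def)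

lemma additive_maps_add:
  "\<lbrakk>f \<in> additive_maps U V; x \<in> carrier U; y \<in> carrier U\<rbrakk> \<Longrightarrow> f (x \<oplus>\<^bsub>U\<^esub> y) = f x \<oplus>\<^bsub>V\<^esub> f y"
  by (auto simp: additive_maps_def hom_def)

lemma additive_maps_compose:
  "\<lbrakk>f \<in> additive_maps U V; g \<in> additive_maps V W\<rbrakk> \<Longrightarrow> (\<lambda>x. g (f x)) \<in> additive_maps U W"
  by (intro additive_mapsI) (simp_all add: additive_maps_closed additive_maps_add)

lemma additive_maps_plus:
  assumes "abelian_group V" "f \<in> additive_maps U V" "g \<in> additive_maps U V"
  shows "(\<lambda>x. f x \<oplus>\<^bsub>V\<^esub> g x) \<in> additive_maps U V"
proof -
  interpret V: abelian_group V by fact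
  show ?thesis
    using assms(2,3)
    by (intro additive_mapsI) (auto simp: additive_maps_closed additive_maps_add V.a_ac)
qed

text \<open>The map below is the one whose values on a coset appear in \<open>tensor_lift\<close>. Its sum runs
  over the support of the argument, which varies, so additivity needs a common index set.\<close>

lemma linear_extension_hom:
  assumes "abelian_group P" and f: "f \<in> S \<rightarrow> carrier P"
  shows "(\<lambda>c. \<Oplus>\<^bsub>P\<^esub>p\<in>Poly_Mapping.keys c. add_pow P (Poly_Mapping.lookup c p) (f p))
    \<in> hom (free_Abelian_group S) (add_monoid P)" (is "?h \<in> _")
proof -
  interpret P: abelian_group P by fact
  have term_closed: "add_pow P k (f p) \<in> carrier P" if "p \<in> S" for p and k :: int
    using f that by (auto intro!: P.add.int_pow_closed)
  \<comment> \<open>Points outside the support contribute zero, so any larger finite index set will do.\<close>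
  have enlarge: "?h c = (\<Oplus>\<^bsub>P\<^esub>p\<in>K. add_pow P (Poly_Mapping.lookup c p) (f p))"
    if "finite K" "Poly_Mapping.keys c \<subseteq> K" "K \<subseteq> S" for c K
  proof (rule P.add.finprod_mono_neutral_cong_left)
    show "\<And>i. i \<in> K - Poly_Mapping.keys c \<Longrightarrow> add_pow P (Poly_Mapping.lookup c i) (f i) = \<zero>\<^bsub>P\<^esub>"
      by (simp add: in_keys_iff add_pow_int_ge)
  qed (use that term_closed in auto)
  show ?thesis
  proof (rule homI)
    fix c assume "c \<in> carrier (free_Abelian_group S)"
    then show "?h c \<in> carrier (add_monoid P)"
      using term_closed by (auto intro!: P.finsum_closed)
  next
    fix c d assume c: "c \<in> carrier (free_Abelian_group S)" and d: "d \<in> carrier (free_Abelian_group S)"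
    define K where "K = Poly_Mapping.keys c \<union> Poly_Mapping.keys d"
    have K: "finite K" "K \<subseteq> S" using c d by (auto simp: K_def)
    have "?h (c + d) = (\<Oplus>\<^bsub>P\<^esub>p\<in>K. add_pow P (Poly_Mapping.lookup (c + d) p) (f p))"
      using K keys_add[of c d] by (intro enlarge) (auto simp: K_def)
    also have "\<dots> = (\<Oplus>\<^bsub>P\<^esub>p\<in>K. add_pow P (Poly_Mapping.lookup c p) (f p) \<oplus>\<^bsub>P\<^esub> add_pow P (Poly_Mapping.lookup d p) (f p))"
    proof (rule P.add.finprod_cong')
      show "add_pow P (Poly_Mapping.lookup (c + d) p) (f p)
          = add_pow P (Poly_Mapping.lookup c p) (f p) \<oplus>\<^bsub>P\<^esub> add_pow P (Poly_Mapping.lookup d p) (f p)"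
        if "p \<in> K" for p
        using f K that by (auto simp: Poly_Mapping.lookup_add intro!: P.add.int_pow_mult)
    qed (use K term_closed in \<open>auto intro!: P.a_closed\<close>)
    also have "\<dots> = ?h c \<oplus>\<^bsub>P\<^esub> ?h d"
      using K term_closed enlarge[of K c] enlarge[of K d]
      by (subst P.finsum_addf) (auto simp: K_def)
    finally show "?h (c \<otimes>\<^bsub>free_Abelian_group S\<^esub> d) = ?h c \<otimes>\<^bsub>add_monoid P\<^esub> ?h d"
      by simp
  qed
qed

lemma linear_extension_frag_of:
  assumes "abelian_group P" and "f x \<in> carrier P"
  shows "(\<Oplus>\<^bsub>P\<^esub>p\<in>Poly_Mapping.keys (frag_of x). add_pow P (Poly_Mapping.lookup (frag_of x) p) (f p)) = f x"
proof -
  interpret P: abelian_group P by fact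
  show ?thesis
    using assms(2) P.finsum_insert[of "{}" x "\<lambda>p. add_pow P (Poly_Mapping.lookup (frag_of x) p) (f p)"]
    by (auto simp: P.add.int_pow_1)
qed

lemma hom_free_Abelian_group_diff:
  assumes "abelian_group P" "h \<in> hom (free_Abelian_group S) (add_monoid P)"
    and "Poly_Mapping.keys c \<subseteq> S" "Poly_Mapping.keys d \<subseteq> S"
  shows "h (c - d) = h c \<ominus>\<^bsub>P\<^esub> h d"
proof -
  interpret P: abelian_group P by fact
  interpret h: group_hom "free_Abelian_group S" "add_monoid P" h
    using assms(2) P.a_group by (simp add: group_hom_def group_hom_axioms_def)
  have "h (c - d) = h (c \<otimes>\<^bsub>free_Abelian_group S\<^esub> inv\<^bsub>free_Abelian_group S\<^esub> d)"
    using assms(3,4) by simp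
  also have "\<dots> = h c \<oplus>\<^bsub>P\<^esub> h (inv\<^bsub>free_Abelian_group S\<^esub> d)"
    using assms(3,4) by (subst h.hom_mult) auto
  also have "h (inv\<^bsub>free_Abelian_group S\<^esub> d) = inv\<^bsub>add_monoid P\<^esub> (h d)"
    using assms(4) by (intro h.hom_inv) auto
  finally show ?thesis by (simp add: a_minus_def a_inv_def)
qed


section \<open>The universal property of the tensor product\<close>

definition balanced_maps ::
    "('a, 'r) ring_scheme \<Rightarrow> ('a, 'm, 'x) right_module_scheme \<Rightarrow>
      ('a, 'n, 'y) bimodule_scheme \<Rightarrow> ('p, 'z) ring_scheme \<Rightarrow> ('m \<Rightarrow> 'n \<Rightarrow> 'p) set" where
  "balanced_maps R M N P = {b.
     (\<forall>m\<in>carrier M. b m \<in> additive_maps N P) \<and>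
     (\<forall>n\<in>carrier N. (\<lambda>m. b m n) \<in> additive_maps M P) \<and>
     (\<forall>m\<in>carrier M. \<forall>a\<in>carrier R. \<forall>n\<in>carrier N. b (m \<triangleleft>\<^bsub>M\<^esub> a) n = b m (a \<triangleright>\<^bsub>N\<^esub> n))}"

lemma balanced_mapsI:
  assumes "\<And>m. m \<in> carrier M \<Longrightarrow> b m \<in> additive_maps N P"
    and "\<And>n. n \<in> carrier N \<Longrightarrow> (\<lambda>m. b m n) \<in> additive_maps M P"
    and "\<And>m a n. \<lbrakk>m \<in> carrier M; a \<in> carrier R; n \<in> carrier N\<rbrakk> \<Longrightarrow>
      b (m \<triangleleft>\<^bsub>M\<^esub> a) n = b m (a \<triangleright>\<^bsub>N\<^esub> n)"
  shows "b \<in> balanced_maps R M N P"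
  using assms by (auto simp: balanced_maps_def)

lemma balanced_mapsD:
  assumes "b \<in> balanced_maps R M N P"
  shows "m \<in> carrier M \<Longrightarrow> b m \<in> additive_maps N P"
    and "n \<in> carrier N \<Longrightarrow> (\<lambda>m. b m n) \<in> additive_maps M P"
    and "\<lbrakk>m \<in> carrier M; a \<in> carrier R; n \<in> carrier N\<rbrakk> \<Longrightarrow>
      b (m \<triangleleft>\<^bsub>M\<^esub> a) n = b m (a \<triangleright>\<^bsub>N\<^esub> n)"
    and "\<lbrakk>m \<in> carrier M; n \<in> carrier N\<rbrakk> \<Longrightarrow> b m n \<in> carrier P"
  using assms by (auto simp: balanced_maps_def intro: additive_maps_closed)

locale tensor_product = M: right_module R M + N: bimodule R N
  for R :: "('a, 'r) ring_scheme"
    and M :: "('a, 'm, 'x) right_module_scheme"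
    and N :: "('a, 'n, 'y) bimodule_scheme"
begin

abbreviation "F \<equiv> free_Abelian_group (carrier M \<times> carrier N)"
abbreviation "K \<equiv> tensor_kernel R M N"
abbreviation "T \<equiv> tensor_group R M N"
abbreviation "pure \<equiv> pure_tensor R M N"

lemma relations_subset: "tensor_relations R M N \<subseteq> carrier F"
proof -
  have "Poly_Mapping.keys (c - d) \<subseteq> S"
    if "Poly_Mapping.keys c \<subseteq> S" "Poly_Mapping.keys d \<subseteq> S" for c d :: "'m \<times> 'n \<Rightarrow>\<^sub>0 int" and S
    using that keys_diff[of c d] by blast
  then show ?thesis
    unfolding tensor_relations_def
    by (auto simp: M.rsmult_closed N.lsmult_closed)
qed

lemma kernel_subgroup: "subgroup K F"
  unfolding tensor_kernel_def by (rule group.generate_is_subgroup) (simp_all add: relations_subset)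

lemma kernel_normal: "K \<lhd> F"
  by (rule comm_group.subgroup_imp_normal[OF abelian_free_Abelian_group kernel_subgroup])

lemma tensor_group_carrier: "carrier T = (\<lambda>c. K #>\<^bsub>F\<^esub> c) ` carrier F"
  by (simp add: tensor_group_def Let_def carrier_FactGroup)

lemma tensor_group_abelian: "abelian_group T"
proof -
  interpret Q: comm_group "F Mod K"
    by (rule comm_group.abelian_FactGroup[OF abelian_free_Abelian_group kernel_subgroup])
  have T: "carrier T = carrier (F Mod K)" "add T = monoid.mult (F Mod K)" "\<zero>\<^bsub>T\<^esub> = \<one>\<^bsub>F Mod K\<^esub>"
    by (simp_all add: tensor_group_def Let_def)
  show ?thesis
    by (rule abelian_groupI; unfold T) (auto simp: Q.m_ac simp del: mult_FactGroup one_FactGroup intro: Q.l_inv_ex)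
qed

sublocale T: abelian_group T by (rule tensor_group_abelian)

lemma coset_hom: "(\<lambda>c. K #>\<^bsub>F\<^esub> c) \<in> hom F (add_monoid T)"
  using normal.r_coset_hom_Mod[OF kernel_normal] by (simp add: hom_def tensor_group_def Let_def)

lemma coset_eq_zero: "c \<in> K \<Longrightarrow> K #>\<^bsub>F\<^esub> c = \<zero>\<^bsub>T\<^esub>"
  using subgroup.rcos_const[OF kernel_subgroup] by (simp add: tensor_group_def Let_def)

lemma pure_closed: "\<lbrakk>m \<in> carrier M; n \<in> carrier N\<rbrakk> \<Longrightarrow> pure m n \<in> carrier T"
  by (auto simp: pure_tensor_def tensor_group_carrier)

text \<open>Closure under differences suffices because the generators of a free abelian group
  generate it under subtraction.\<close>

lemma tensor_induct [consumes 1, case_names zero pure diff]: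
  assumes "t \<in> carrier T" and "Q \<zero>\<^bsub>T\<^esub>"
    and "\<And>m n. \<lbrakk>m \<in> carrier M; n \<in> carrier N\<rbrakk> \<Longrightarrow> Q (pure m n)"
    and "\<And>t u. \<lbrakk>t \<in> carrier T; u \<in> carrier T; Q t; Q u\<rbrakk> \<Longrightarrow> Q (t \<ominus>\<^bsub>T\<^esub> u)"
  shows "Q t"
proof -
  obtain c where c: "Poly_Mapping.keys c \<subseteq> carrier M \<times> carrier N" and t: "t = K #>\<^bsub>F\<^esub> c"
    using assms(1) by (auto simp: tensor_group_carrier)
  have "Q (K #>\<^bsub>F\<^esub> c)"
  proof (rule free_Abelian_group_induct[OF c, where P = "\<lambda>c. Q (K #>\<^bsub>F\<^esub> c)"])
    have "0 \<in> K" using subgroup.one_closed[OF kernel_subgroup] by simp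
    then show "Q (K #>\<^bsub>F\<^esub> 0)" using assms(2) by (simp add: coset_eq_zero)
  next
    fix x y :: "'m \<times> 'n \<Rightarrow>\<^sub>0 int"
    assume "Poly_Mapping.keys x \<subseteq> carrier M \<times> carrier N" "Poly_Mapping.keys y \<subseteq> carrier M \<times> carrier N"
      "Q (K #>\<^bsub>F\<^esub> x)" "Q (K #>\<^bsub>F\<^esub> y)"
    then show "Q (K #>\<^bsub>F\<^esub> (x - y))"
      using assms(4) by (simp add: hom_free_Abelian_group_diff[OF tensor_group_abelian coset_hom]
          tensor_group_carrier)
  next
    fix p assume "p \<in> carrier M \<times> carrier N"
    then show "Q (K #>\<^bsub>F\<^esub> frag_of p)" using assms(3) by (auto simp: pure_tensor_def)
  qed
  then show ?thesis by (simp add: t)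
qed

text \<open>All identities between maps on tensor products are reduced to pure tensors by this
  principle, including the module axioms, each read as an equality of additive maps in the tensor.\<close>

lemma additive_maps_eqI:
  assumes "abelian_group P" and f: "f \<in> additive_maps T P" and g: "g \<in> additive_maps T P"
    and eq: "\<And>m n. \<lbrakk>m \<in> carrier M; n \<in> carrier N\<rbrakk> \<Longrightarrow> f (pure m n) = g (pure m n)"
    and "t \<in> carrier T"
  shows "f t = g t"
proof -
  interpret P: abelian_group P by fact
  interpret f: group_hom "add_monoid T" "add_monoid P" f
    using f P.a_group T.a_group by (simp add: group_hom_def group_hom_axioms_def additive_maps_def)
  interpret g: group_hom "add_monoid T" "add_monoid P" g
    using g P.a_group T.a_group by (simp add: group_hom_def group_hom_axioms_def additive_maps_def)
  show ?thesis
    using \<open>t \<in> carrier T\<close>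
  proof (induction rule: tensor_induct)
    case zero
    show ?case using f.hom_one g.hom_one by simp
  next
    case (pure m n)
    then show ?case by (rule eq)
  next
    case (diff t u)
    then show ?case
      using f.hom_mult[of t "\<ominus>\<^bsub>T\<^esub> u"] g.hom_mult[of t "\<ominus>\<^bsub>T\<^esub> u"] f.hom_inv[of u] g.hom_inv[of u]
      by (simp add: a_minus_def) (simp add: a_inv_def)
  qed
qed

text \<open>Each of the three families of relations lies in \<^term>\<open>K\<close>, so the two sides of each
  relation have the same coset.\<close>

lemma pure_balanced: "pure \<in> balanced_maps R M N T"
proof -
  have coset_add: "K #>\<^bsub>F\<^esub> (c + d) = (K #>\<^bsub>F\<^esub> c) \<oplus>\<^bsub>T\<^esub> (K #>\<^bsub>F\<^esub> d)" if "c \<in> carrier F" "d \<in> carrier F" for c d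
    using coset_hom that by (auto simp: hom_def)
  have coset_closed: "K #>\<^bsub>F\<^esub> c \<in> carrier T" if "c \<in> carrier F" for c
    using that by (auto simp: tensor_group_carrier)
  have cong: "K #>\<^bsub>F\<^esub> c = K #>\<^bsub>F\<^esub> d" if "c - d \<in> tensor_relations R M N" "d \<in> carrier F" for c d
  proof -
    have "K #>\<^bsub>F\<^esub> (c - d) = \<zero>\<^bsub>T\<^esub>"
      using that(1) by (intro coset_eq_zero) (auto simp: tensor_kernel_def intro: generate.incl)
    moreover have "c - d \<in> carrier F"
      using that(1) relations_subset by blast
    ultimately show ?thesis
      using coset_add[of "c - d" d] that(2) coset_closed[of d] by simp
  qed
  have frag_add: "frag_of p + frag_of q \<in> carrier F" if "p \<in> carrier M \<times> carrier N" "q \<in> carrier M \<times> carrier N" for p q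
    using that keys_add[of "frag_of p" "frag_of q"] by auto
  show ?thesis
  proof (intro balanced_mapsI additive_mapsI pure_closed)
    fix m n n' assume m: "m \<in> carrier M" and n: "n \<in> carrier N" "n' \<in> carrier N"
    have "frag_of (m, n \<oplus>\<^bsub>N\<^esub> n') - frag_of (m, n) - frag_of (m, n') \<in> tensor_relations R M N"
      using m n by (auto simp: tensor_relations_def)
    then show "pure m (n \<oplus>\<^bsub>N\<^esub> n') = pure m n \<oplus>\<^bsub>T\<^esub> pure m n'"
      using m n by (auto simp: pure_tensor_def diff_diff_add coset_add[symmetric] intro!: cong frag_add)
  next
    fix m m' n assume m: "m \<in> carrier M" "m' \<in> carrier M" and n: "n \<in> carrier N"
    have "frag_of (m \<oplus>\<^bsub>M\<^esub> m', n) - frag_of (m, n) - frag_of (m', n) \<in> tensor_relations R M N"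
      using m n by (auto simp: tensor_relations_def)
    then show "pure (m \<oplus>\<^bsub>M\<^esub> m') n = pure m n \<oplus>\<^bsub>T\<^esub> pure m' n"
      using m n by (auto simp: pure_tensor_def diff_diff_add coset_add[symmetric] intro!: cong frag_add)
  next
    fix m a n assume "m \<in> carrier M" "a \<in> carrier R" "n \<in> carrier N"
    then show "pure (m \<triangleleft>\<^bsub>M\<^esub> a) n = pure m (a \<triangleright>\<^bsub>N\<^esub> n)"
      by (auto simp: pure_tensor_def tensor_relations_def N.lsmult_closed intro!: cong)
  qed auto
qed

lemmas pure_add_right = additive_maps_add[OF balanced_mapsD(1)[OF pure_balanced]]
lemmas pure_add_left = additive_maps_add[OF balanced_mapsD(2)[OF pure_balanced]]
lemmas pure_middle = balanced_mapsD(3)[OF pure_balanced]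

text \<open>A balanced map respects the defining relations, so its linear extension vanishes on
  \<^term>\<open>K\<close> and therefore takes a single value on each coset.\<close>

lemma tensor_lift_coset:
  assumes P: "abelian_group P" and b: "b \<in> balanced_maps R M N P" and c: "c \<in> carrier F"
  defines "h \<equiv> \<lambda>c. \<Oplus>\<^bsub>P\<^esub>p\<in>Poly_Mapping.keys c. add_pow P (Poly_Mapping.lookup c p) (b (fst p) (snd p))"
  shows "tensor_lift P b (K #>\<^bsub>F\<^esub> c) = h c"
proof -
  interpret P: abelian_group P by fact
  have h: "h \<in> hom F (add_monoid P)"
    unfolding h_def using balanced_mapsD(4)[OF b] by (intro linear_extension_hom P) auto
  have h_frag: "h (frag_of (m, n)) = b m n" if "m \<in> carrier M" "n \<in> carrier N" for m n
    using linear_extension_frag_of[OF P, of "\<lambda>p. b (fst p) (snd p)" "(m, n)"] balanced_mapsD(4)[OF b] that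
    by (simp add: h_def)
  interpret h: group_hom F "add_monoid P" h
    using h P.a_group by (simp add: group_hom_def group_hom_axioms_def)
  note diff = hom_free_Abelian_group_diff[OF P h]
  have keys_diff': "Poly_Mapping.keys (frag_of p - frag_of q) \<subseteq> carrier M \<times> carrier N"
    if "p \<in> carrier M \<times> carrier N" "q \<in> carrier M \<times> carrier N" for p q :: "'m \<times> 'n"
    using that keys_diff[of "frag_of p" "frag_of q"] by auto
  have cancel: "x \<oplus>\<^bsub>P\<^esub> y \<ominus>\<^bsub>P\<^esub> x \<ominus>\<^bsub>P\<^esub> y = \<zero>\<^bsub>P\<^esub>" if "x \<in> carrier P" "y \<in> carrier P" for x y
    using that P.r_neg[of "x \<oplus>\<^bsub>P\<^esub> y"] by (simp add: a_minus_def P.minus_add P.a_assoc)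
  have self: "x \<ominus>\<^bsub>P\<^esub> x = \<zero>\<^bsub>P\<^esub>" if "x \<in> carrier P" for x
    using that by (simp add: a_minus_def P.r_neg)
  have "h r = \<zero>\<^bsub>P\<^esub>" if "r \<in> tensor_relations R M N" for r
    using that b
    by (auto simp: tensor_relations_def diff keys_diff' h_frag M.rsmult_closed N.lsmult_closed
        balanced_mapsD additive_maps_add[OF balanced_mapsD(1)[OF b]]
        additive_maps_add[OF balanced_mapsD(2)[OF b]] cancel self)
  then have "tensor_relations R M N \<subseteq> kernel F (add_monoid P) h"
    using relations_subset by (auto simp: kernel_def simp del: carrier_free_Abelian_group_iff)
  then have K: "K \<subseteq> kernel F (add_monoid P) h"
    unfolding tensor_kernel_def
    by (intro group.generate_subgroup_incl h.subgroup_kernel) simp_all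
  have "h ` (K #>\<^bsub>F\<^esub> c) = {h c}"
  proof -
    have "h (k + c) = h c" if "k \<in> K" for k
      using K that c h.hom_mult[of k c] h.hom_closed[of c] by (auto simp: kernel_def)
    moreover have "0 \<in> K" using subgroup.one_closed[OF kernel_subgroup] by simp
    ultimately show ?thesis by (force simp: r_coset_def)
  qed
  then show ?thesis by (simp add: tensor_lift_def h_def)
qed

lemma tensor_lift_additive:
  assumes P: "abelian_group P" and b: "b \<in> balanced_maps R M N P"
  shows "tensor_lift P b \<in> additive_maps T P"
proof (rule additive_mapsI)
  let ?h = "\<lambda>c. \<Oplus>\<^bsub>P\<^esub>p\<in>Poly_Mapping.keys c. add_pow P (Poly_Mapping.lookup c p) (b (fst p) (snd p))"
  have h: "?h \<in> hom F (add_monoid P)"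
    using balanced_mapsD(4)[OF b] by (intro linear_extension_hom P) auto
  fix t assume "t \<in> carrier T"
  then obtain c where c: "c \<in> carrier F" "t = K #>\<^bsub>F\<^esub> c"
    by (auto simp: tensor_group_carrier)
  show "tensor_lift P b t \<in> carrier P"
    using hom_in_carrier[OF h c(1)] by (simp add: c tensor_lift_coset[OF P b c(1)])
  fix u assume "u \<in> carrier T"
  then obtain d where d: "d \<in> carrier F" "u = K #>\<^bsub>F\<^esub> d"
    by (auto simp: tensor_group_carrier)
  have cd: "c + d \<in> carrier F" using c d keys_add[of c d] by auto
  have "t \<oplus>\<^bsub>T\<^esub> u = K #>\<^bsub>F\<^esub> (c + d)"
    using hom_mult[OF coset_hom c(1) d(1)] by (simp add: c d)
  then show "tensor_lift P b (t \<oplus>\<^bsub>T\<^esub> u) = tensor_lift P b t \<oplus>\<^bsub>P\<^esub> tensor_lift P b u"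
    using hom_mult[OF h c(1) d(1)]
    by (simp add: c(2) d(2) tensor_lift_coset[OF P b c(1)] tensor_lift_coset[OF P b d(1)]
        tensor_lift_coset[OF P b cd])
qed

lemma tensor_lift_pure:
  assumes P: "abelian_group P" and b: "b \<in> balanced_maps R M N P"
    and "m \<in> carrier M" "n \<in> carrier N"
  shows "tensor_lift P b (pure m n) = b m n"
  using assms tensor_lift_coset[OF P b, of "frag_of (m, n)"]
    linear_extension_frag_of[OF P, of "\<lambda>p. b (fst p) (snd p)" "(m, n)"]
  by (simp add: pure_tensor_def balanced_mapsD(4)[OF b])

end


section \<open>Tensor products of modules and bimodules\<close>

definition left_module_hom ::
    "('a, 'r) ring_scheme \<Rightarrow> ('a, 'm, 'x) bimodule_scheme \<Rightarrow>
      ('a, 'n, 'y) bimodule_scheme \<Rightarrow> ('m \<Rightarrow> 'n) set" where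
  "left_module_hom R M N = {f \<in> additive_maps M N.
     \<forall>a\<in>carrier R. \<forall>m\<in>carrier M. f (a \<triangleright>\<^bsub>M\<^esub> m) = a \<triangleright>\<^bsub>N\<^esub> f m}"

lemma right_module_hom_additive: "f \<in> right_module_hom R M N \<Longrightarrow> f \<in> additive_maps M N"
  by (auto simp: right_module_hom_def intro!: additive_mapsI)

lemma right_module_hom_closed: "\<lbrakk>f \<in> right_module_hom R M N; m \<in> carrier M\<rbrakk> \<Longrightarrow> f m \<in> carrier N"
  by (auto simp: right_module_hom_def)

lemma right_module_hom_id: "id \<in> right_module_hom R M M"
  by (auto simp: right_module_hom_def)

lemma left_module_hom_additive: "f \<in> left_module_hom R M N \<Longrightarrow> f \<in> additive_maps M N"
  by (auto simp: left_module_hom_def)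

lemma left_module_hom_closed: "\<lbrakk>f \<in> left_module_hom R M N; m \<in> carrier M\<rbrakk> \<Longrightarrow> f m \<in> carrier N"
  by (auto simp: left_module_hom_def intro: additive_maps_closed)

lemma left_module_hom_id: "id \<in> left_module_hom R M M"
  by (auto simp: left_module_hom_def intro!: additive_mapsI)

lemma bimodule_hom_imp_left: "f \<in> bimodule_hom R M N \<Longrightarrow> f \<in> left_module_hom R M N"
  by (auto simp: bimodule_hom_def left_module_hom_def right_module_hom_additive)

lemma bimodule_hom_imp_right: "f \<in> bimodule_hom R M N \<Longrightarrow> f \<in> right_module_hom R M N"
  by (auto simp: bimodule_hom_def)

text \<open>The scalar multiplications on \<open>M \<otimes> N\<close>, the maps \<open>f \<otimes> g\<close> and the rebracketing map all
  come from composing the universal balanced map with linear maps in each factor.\<close>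

lemma balanced_maps_compose:
  assumes b: "b \<in> balanced_maps R M' N' P"
    and f: "f \<in> right_module_hom R M M'" and g: "g \<in> left_module_hom R N N'"
  shows "(\<lambda>m n. b (f m) (g n)) \<in> balanced_maps R M N P"
proof (rule balanced_mapsI)
  fix m assume "m \<in> carrier M"
  then show "(\<lambda>n. b (f m) (g n)) \<in> additive_maps N P"
    using additive_maps_compose[OF left_module_hom_additive[OF g] balanced_mapsD(1)[OF b]]
      right_module_hom_closed[OF f] by blast
next
  fix n assume "n \<in> carrier N"
  then show "(\<lambda>m. b (f m) (g n)) \<in> additive_maps M P"
    using additive_maps_compose[OF right_module_hom_additive[OF f] balanced_mapsD(2)[OF b]]
      left_module_hom_closed[OF g] by blast
next
  fix m a n assume "m \<in> carrier M" "a \<in> carrier R" "n \<in> carrier N"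
  then show "b (f (m \<triangleleft>\<^bsub>M\<^esub> a)) (g n) = b (f m) (g (a \<triangleright>\<^bsub>N\<^esub> n))"
    using f g balanced_mapsD(3)[OF b] right_module_hom_closed[OF f] left_module_hom_closed[OF g]
    by (auto simp: right_module_hom_def left_module_hom_def)
qed

lemma (in bimodule) rsmult_left_module_hom:
  "a \<in> carrier R \<Longrightarrow> (\<lambda>m. m \<triangleleft>\<^bsub>M\<^esub> a) \<in> left_module_hom R M M"
  by (auto simp: left_module_hom_def rsmult_closed rsmult_l_distr lsmult_rsmult intro!: additive_mapsI)

lemma (in bimodule) lsmult_right_module_hom:
  "a \<in> carrier R \<Longrightarrow> (\<lambda>m. a \<triangleright>\<^bsub>M\<^esub> m) \<in> right_module_hom R M M"
  by (auto simp: right_module_hom_def lsmult_closed lsmult_r_distr lsmult_rsmult)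

lemma tensor_map_pure:
  assumes "tensor_product R M N" "tensor_product R M' N'"
    and f: "f \<in> right_module_hom R M M'" and g: "g \<in> left_module_hom R N N'"
    and "m \<in> carrier M" "n \<in> carrier N"
  shows "tensor_map R M' N' f g (pure_tensor R M N m n) = pure_tensor R M' N' (f m) (g n)"
proof -
  interpret MN: tensor_product R M N by fact
  interpret MN': tensor_product R M' N' by fact
  show ?thesis
    unfolding tensor_map_def
    using MN.tensor_lift_pure[OF MN'.tensor_group_abelian balanced_maps_compose[OF MN'.pure_balanced f g]]
      assms(5,6) by simp
qed

lemma tensor_right_module_simps [simp]:
  "carrier (tensor_right_module R M N) = carrier (tensor_group R M N)"
  "add (tensor_right_module R M N) = add (tensor_group R M N)"
  "\<zero>\<^bsub>tensor_right_module R M N\<^esub> = \<zero>\<^bsub>tensor_group R M N\<^esub>"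
  by (simp_all add: tensor_right_module_def ring.defs right_module.defs)

lemma tensor_rsmult_def:
  "rsmult (tensor_right_module R M N) =
    (\<lambda>t a. tensor_lift (tensor_group R M N) (\<lambda>m n. pure_tensor R M N m (n \<triangleleft>\<^bsub>N\<^esub> a)) t)"
  by (simp add: tensor_right_module_def ring.defs right_module.defs)

lemma tensor_bimodule_simps [simp]:
  "carrier (tensor_bimodule R M N) = carrier (tensor_group R M N)"
  "add (tensor_bimodule R M N) = add (tensor_group R M N)"
  "\<zero>\<^bsub>tensor_bimodule R M N\<^esub> = \<zero>\<^bsub>tensor_group R M N\<^esub>"
  "rsmult (tensor_bimodule R M N) = rsmult (tensor_right_module R M N)"
  by (simp_all add: tensor_bimodule_def right_module.defs bimodule.defs)

lemma tensor_lsmult_def: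
  "lsmult (tensor_bimodule R M N) =
    (\<lambda>a t. tensor_lift (tensor_group R M N) (\<lambda>m n. pure_tensor R M N (a \<triangleright>\<^bsub>M\<^esub> m) n) t)"
  by (simp add: tensor_bimodule_def right_module.defs bimodule.defs)

lemma abelian_group_cong:
  assumes "abelian_group U" "carrier V = carrier U" "add V = add U" "\<zero>\<^bsub>V\<^esub> = \<zero>\<^bsub>U\<^esub>"
  shows "abelian_group V"
proof -
  interpret U: abelian_group U by fact
  show ?thesis
    by (rule abelian_groupI; unfold assms(2-4)) (auto simp: U.a_ac intro: U.add.l_inv_ex)
qed

context tensor_product
begin

lemma tensor_rsmult:
  assumes "a \<in> carrier R"
  shows tensor_rsmult_additive: "(\<lambda>t. t \<triangleleft>\<^bsub>tensor_right_module R M N\<^esub> a) \<in> additive_maps T T"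
    and tensor_rsmult_pure: "\<lbrakk>m \<in> carrier M; n \<in> carrier N\<rbrakk> \<Longrightarrow>
      pure m n \<triangleleft>\<^bsub>tensor_right_module R M N\<^esub> a = pure m (n \<triangleleft>\<^bsub>N\<^esub> a)"
proof -
  have b: "(\<lambda>m n. pure m (n \<triangleleft>\<^bsub>N\<^esub> a)) \<in> balanced_maps R M N T"
    using balanced_maps_compose[OF pure_balanced right_module_hom_id
        N.rsmult_left_module_hom[OF assms]] by simp
  show "(\<lambda>t. t \<triangleleft>\<^bsub>tensor_right_module R M N\<^esub> a) \<in> additive_maps T T"
    using tensor_lift_additive[OF tensor_group_abelian b] by (simp add: tensor_rsmult_def)
  show "pure m n \<triangleleft>\<^bsub>tensor_right_module R M N\<^esub> a = pure m (n \<triangleleft>\<^bsub>N\<^esub> a)"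
    if "m \<in> carrier M" "n \<in> carrier N"
    using tensor_lift_pure[OF tensor_group_abelian b that] by (simp add: tensor_rsmult_def)
qed

text \<open>For fixed scalars both sides of each axiom are additive in the tensor, so it is inherited
  from the right action on the second factor.\<close>

lemma right_module_tensor: "right_module R (tensor_right_module R M N)"
proof -
  let ?S = "rsmult (tensor_right_module R M N)"
  have id: "(\<lambda>t. t) \<in> additive_maps T T" by (auto intro: additive_mapsI)
  note simps = tensor_rsmult_pure M.rsmult_closed N.rsmult_closed
  note eqI = additive_maps_eqI[OF tensor_group_abelian]
  note smult = tensor_rsmult_additive
  show ?thesis
  proof (intro right_module.intro right_module_axioms.intro)
    show "abelian_group (tensor_right_module R M N)"
      by (rule abelian_group_cong[OF tensor_group_abelian]) simp_all
  next
    fix t a assume "t \<in> carrier (tensor_right_module R M N)" "a \<in> carrier R"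
    then show "?S t a \<in> carrier (tensor_right_module R M N)"
      using additive_maps_closed[OF smult] by simp
  next
    fix t u a
    assume "t \<in> carrier (tensor_right_module R M N)" "u \<in> carrier (tensor_right_module R M N)" "a \<in> carrier R"
    then show "?S (t \<oplus>\<^bsub>tensor_right_module R M N\<^esub> u) a = ?S t a \<oplus>\<^bsub>tensor_right_module R M N\<^esub> ?S u a"
      using additive_maps_add[OF smult] by simp
  next
    fix t a b assume t: "t \<in> carrier (tensor_right_module R M N)" and ab: "a \<in> carrier R" "b \<in> carrier R"
    have "?S t (a \<oplus>\<^bsub>R\<^esub> b) = ?S t a \<oplus>\<^bsub>T\<^esub> ?S t b"
      by (rule eqI[of "\<lambda>t. ?S t (a \<oplus>\<^bsub>R\<^esub> b)" "\<lambda>t. ?S t a \<oplus>\<^bsub>T\<^esub> ?S t b"])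
        (use t ab in \<open>simp_all add: simps additive_maps_plus smult tensor_group_abelian N.rsmult_r_distr pure_add_right\<close>)
    then show "?S t (a \<oplus>\<^bsub>R\<^esub> b) = ?S t a \<oplus>\<^bsub>tensor_right_module R M N\<^esub> ?S t b"
      by simp
    show "?S t (a \<otimes>\<^bsub>R\<^esub> b) = ?S (?S t a) b"
      by (rule eqI[of "\<lambda>t. ?S t (a \<otimes>\<^bsub>R\<^esub> b)" "\<lambda>t. ?S (?S t a) b"])
        (use t ab in \<open>simp_all add: simps additive_maps_compose[OF smult smult] smult N.rsmult_assoc\<close>)
  next
    fix t assume t: "t \<in> carrier (tensor_right_module R M N)"
    show "?S t \<one>\<^bsub>R\<^esub> = t"
      by (rule eqI[of "\<lambda>t. ?S t \<one>\<^bsub>R\<^esub>" "\<lambda>t. t"])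
        (use t in \<open>simp_all add: simps id smult N.rsmult_one\<close>)
  qed (rule M.ring_axioms)
qed

end

locale bimodule_tensor_product = M: bimodule R M + N: bimodule R N
  for R :: "('a, 'r) ring_scheme"
    and M :: "('a, 'm, 'x) bimodule_scheme"
    and N :: "('a, 'n, 'y) bimodule_scheme"
begin

sublocale tensor_product R M N ..

lemma tensor_lsmult:
  assumes "a \<in> carrier R"
  shows tensor_lsmult_additive: "(\<lambda>t. a \<triangleright>\<^bsub>tensor_bimodule R M N\<^esub> t) \<in> additive_maps T T"
    and tensor_lsmult_pure: "\<lbrakk>m \<in> carrier M; n \<in> carrier N\<rbrakk> \<Longrightarrow>
      a \<triangleright>\<^bsub>tensor_bimodule R M N\<^esub> pure m n = pure (a \<triangleright>\<^bsub>M\<^esub> m) n"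
proof -
  have b: "(\<lambda>m n. pure (a \<triangleright>\<^bsub>M\<^esub> m) n) \<in> balanced_maps R M N T"
    using balanced_maps_compose[OF pure_balanced M.lsmult_right_module_hom[OF assms]
        left_module_hom_id] by simp
  show "(\<lambda>t. a \<triangleright>\<^bsub>tensor_bimodule R M N\<^esub> t) \<in> additive_maps T T"
    using tensor_lift_additive[OF tensor_group_abelian b] by (simp add: tensor_lsmult_def)
  show "a \<triangleright>\<^bsub>tensor_bimodule R M N\<^esub> pure m n = pure (a \<triangleright>\<^bsub>M\<^esub> m) n"
    if "m \<in> carrier M" "n \<in> carrier N"
    using tensor_lift_pure[OF tensor_group_abelian b that] by (simp add: tensor_lsmult_def)
qed

text \<open>The left action of \<open>C\<^sub>\<alpha> \<otimes> C\<^sub>\<beta>\<close> matters because the isomorphism \<open>A \<otimes> N \<cong> N\<close> will be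
  used for \<open>N = C\<^sub>\<alpha> \<otimes> C\<^sub>\<beta>\<close>.\<close>

lemma bimodule_tensor: "bimodule R (tensor_bimodule R M N)"
proof -
  interpret TR: right_module R "tensor_right_module R M N" by (rule right_module_tensor)
  let ?B = "tensor_bimodule R M N"
  let ?L = "lsmult ?B"
  let ?S = "rsmult (tensor_right_module R M N)"
  have id: "(\<lambda>t. t) \<in> additive_maps T T" by (auto intro: additive_mapsI)
  note simps = tensor_lsmult_pure tensor_rsmult_pure M.lsmult_closed N.rsmult_closed
  note eqI = additive_maps_eqI[OF tensor_group_abelian]
  note lmult = tensor_lsmult_additive
  show ?thesis
  proof (intro bimodule.intro bimodule_axioms.intro right_module.intro right_module_axioms.intro)
    show "abelian_group ?B"
      by (rule abelian_group_cong[OF tensor_group_abelian]) simp_all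
  next
    fix a t assume "a \<in> carrier R" "t \<in> carrier ?B"
    then show "?L a t \<in> carrier ?B"
      using additive_maps_closed[OF lmult] by simp
  next
    fix a t u assume "a \<in> carrier R" "t \<in> carrier ?B" "u \<in> carrier ?B"
    then show "?L a (t \<oplus>\<^bsub>?B\<^esub> u) = ?L a t \<oplus>\<^bsub>?B\<^esub> ?L a u"
      using additive_maps_add[OF lmult] by simp
  next
    fix a b t assume ab: "a \<in> carrier R" "b \<in> carrier R" and t: "t \<in> carrier ?B"
    have "?L (a \<oplus>\<^bsub>R\<^esub> b) t = ?L a t \<oplus>\<^bsub>T\<^esub> ?L b t"
      by (rule eqI[of "?L (a \<oplus>\<^bsub>R\<^esub> b)" "\<lambda>t. ?L a t \<oplus>\<^bsub>T\<^esub> ?L b t"])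
        (use t ab in \<open>simp_all add: simps additive_maps_plus lmult tensor_group_abelian M.lsmult_l_distr pure_add_left\<close>)
    then show "?L (a \<oplus>\<^bsub>R\<^esub> b) t = ?L a t \<oplus>\<^bsub>?B\<^esub> ?L b t"
      by simp
    show "?L (a \<otimes>\<^bsub>R\<^esub> b) t = ?L a (?L b t)"
      by (rule eqI[of "?L (a \<otimes>\<^bsub>R\<^esub> b)" "\<lambda>t. ?L a (?L b t)"])
        (use t ab in \<open>simp_all add: simps additive_maps_compose[OF lmult lmult] lmult M.lsmult_assoc\<close>)
  next
    fix t assume t: "t \<in> carrier ?B"
    show "?L \<one>\<^bsub>R\<^esub> t = t"
      by (rule eqI[of "?L \<one>\<^bsub>R\<^esub>" "\<lambda>t. t"])
        (use t in \<open>simp_all add: simps id lmult M.lsmult_one\<close>)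
  next
    fix a t b assume a: "a \<in> carrier R" and t: "t \<in> carrier ?B" and b: "b \<in> carrier R"
    show "?L a t \<triangleleft>\<^bsub>?B\<^esub> b = ?L a (t \<triangleleft>\<^bsub>?B\<^esub> b)"
      unfolding tensor_bimodule_simps
      by (rule eqI[of "\<lambda>t. ?S (?L a t) b" "\<lambda>t. ?L a (?S t b)"])
        (use a b t in \<open>simp_all add: simps additive_maps_compose[OF lmult tensor_rsmult_additive]
          additive_maps_compose[OF tensor_rsmult_additive lmult]\<close>)
  qed (use TR.rsmult_closed TR.rsmult_l_distr TR.rsmult_r_distr TR.rsmult_assoc TR.rsmult_one
      M.ring_axioms in simp_all)
qed

end


section \<open>The canonical isomorphisms on pure tensors\<close>

locale triple_tensor_product = MN: tensor_product R M N + NP: bimodule_tensor_product R N P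
  for R :: "('a, 'r) ring_scheme"
    and M :: "('a, 'm, 'x) right_module_scheme"
    and N :: "('a, 'n, 'y) bimodule_scheme"
    and P :: "('a, 'p, 'z) bimodule_scheme"
begin

sublocale left: tensor_product R "tensor_right_module R M N" P
  by (intro tensor_product.intro MN.right_module_tensor NP.N.bimodule_axioms)

sublocale right: tensor_product R M "tensor_bimodule R N P"
  by (intro tensor_product.intro MN.M.right_module_axioms NP.bimodule_tensor)

text \<open>Rebracketing with the third factor fixed, \<open>m \<otimes> n \<mapsto> m \<otimes> (n \<otimes> p)\<close>; letting \<open>p\<close> vary
  gives the associator.\<close>

abbreviation rebracket where
  "rebracket p \<equiv> tensor_lift right.T (\<lambda>m n. right.pure m (NP.pure n p))"

lemma rebracket_balanced:
  assumes p: "p \<in> carrier P"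
  shows "(\<lambda>m n. right.pure m (NP.pure n p)) \<in> balanced_maps R M N right.T"
proof -
  have "(\<lambda>n. NP.pure n p) \<in> left_module_hom R N (tensor_bimodule R N P)"
    using p balanced_mapsD(2)[OF NP.pure_balanced]
    by (auto simp: left_module_hom_def NP.tensor_lsmult_pure additive_maps_def hom_def)
  then show ?thesis
    using balanced_maps_compose[OF right.pure_balanced right_module_hom_id] by simp
qed

lemmas rebracket_additive = MN.tensor_lift_additive[OF right.tensor_group_abelian rebracket_balanced]
lemmas rebracket_pure = MN.tensor_lift_pure[OF right.tensor_group_abelian rebracket_balanced]

text \<open>Additivity in \<open>p\<close> and compatibility with scalars hold for pure \<open>t = m \<otimes> n\<close> by the
  corresponding properties of \<open>n \<otimes> p\<close>; both sides are additive in \<open>t\<close>, so they hold for all \<open>t\<close>.\<close>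

lemma tensor_assoc_balanced:
  "(\<lambda>t p. rebracket p t) \<in> balanced_maps R (tensor_right_module R M N) P right.T"
proof (rule balanced_mapsI)
  fix p assume "p \<in> carrier P"
  then show "(\<lambda>t. rebracket p t) \<in> additive_maps (tensor_right_module R M N) right.T"
    using rebracket_additive by (simp add: additive_maps_cong[of "tensor_right_module R M N" MN.T])
next
  fix t assume t: "t \<in> carrier (tensor_right_module R M N)"
  show "(\<lambda>p. rebracket p t) \<in> additive_maps P right.T"
  proof (rule additive_mapsI)
    fix p assume p: "p \<in> carrier P"
    show "rebracket p t \<in> carrier right.T"
      using additive_maps_closed[OF rebracket_additive[OF p]] t by simp
    fix q assume q: "q \<in> carrier P"
    show "rebracket (p \<oplus>\<^bsub>P\<^esub> q) t = rebracket p t \<oplus>\<^bsub>right.T\<^esub> rebracket q t"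
    proof (rule MN.additive_maps_eqI[OF right.tensor_group_abelian])
      fix m n assume mn: "m \<in> carrier M" "n \<in> carrier N"
      then show "rebracket (p \<oplus>\<^bsub>P\<^esub> q) (MN.pure m n) =
          rebracket p (MN.pure m n) \<oplus>\<^bsub>right.T\<^esub> rebracket q (MN.pure m n)"
        using p q right.pure_add_right[of m "NP.pure n p" "NP.pure n q"]
        by (simp add: rebracket_pure NP.pure_add_right NP.pure_closed)
    qed (use p q t in \<open>auto intro!: additive_maps_plus rebracket_additive right.tensor_group_abelian\<close>)
  qed
next
  fix t a p assume t: "t \<in> carrier (tensor_right_module R M N)" and a: "a \<in> carrier R" and p: "p \<in> carrier P"
  have ap: "a \<triangleright>\<^bsub>P\<^esub> p \<in> carrier P" using a p by (rule NP.N.lsmult_closed)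
  show "rebracket p (t \<triangleleft>\<^bsub>tensor_right_module R M N\<^esub> a) = rebracket (a \<triangleright>\<^bsub>P\<^esub> p) t"
  proof (rule MN.additive_maps_eqI[OF right.tensor_group_abelian])
    show "(\<lambda>t. rebracket p (t \<triangleleft>\<^bsub>tensor_right_module R M N\<^esub> a)) \<in> additive_maps MN.T right.T"
      by (rule additive_maps_compose[OF MN.tensor_rsmult_additive rebracket_additive]) fact+
    fix m n assume mn: "m \<in> carrier M" "n \<in> carrier N"
    then show "rebracket p (MN.pure m n \<triangleleft>\<^bsub>tensor_right_module R M N\<^esub> a) = rebracket (a \<triangleright>\<^bsub>P\<^esub> p) (MN.pure m n)"
      using a p ap
      by (simp add: MN.tensor_rsmult_pure rebracket_pure MN.N.rsmult_closed NP.pure_middle)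
  qed (use t ap in \<open>auto intro: rebracket_additive\<close>)
qed

lemma tensor_assoc_pure:
  assumes "m \<in> carrier M" "n \<in> carrier N" "p \<in> carrier P"
  shows "tensor_assoc R M N P (left.pure (MN.pure m n) p) = right.pure m (NP.pure n p)"
  using assms left.tensor_lift_pure[OF right.tensor_group_abelian tensor_assoc_balanced]
  by (simp add: tensor_assoc_def Let_def MN.pure_closed rebracket_pure)

end

lemma regular_bimodule_simps [simp]:
  "carrier (regular_bimodule R) = carrier R"
  "add (regular_bimodule R) = add R"
  "\<zero>\<^bsub>regular_bimodule R\<^esub> = \<zero>\<^bsub>R\<^esub>"
  "rsmult (regular_bimodule R) = monoid.mult R"
  "lsmult (regular_bimodule R) = monoid.mult R"
  by (simp_all add: regular_bimodule_def)

lemma (in ring) bimodule_regular: "bimodule R (regular_bimodule R)"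
  by (intro bimodule.intro bimodule_axioms.intro right_module.intro right_module_axioms.intro
      abelian_group_cong[OF is_abelian_group])
    (simp_all add: l_distr r_distr m_assoc ring_axioms)

lemma (in right_module) tensor_right_unit_pure:
  assumes "m \<in> carrier M" "a \<in> carrier R"
  shows "tensor_right_unit M (pure_tensor R M (regular_bimodule R) m a) = m \<triangleleft>\<^bsub>M\<^esub> a"
proof -
  interpret tensor_product R M "regular_bimodule R"
    by (intro tensor_product.intro right_module_axioms bimodule_regular)
  have b: "(\<lambda>m a. m \<triangleleft>\<^bsub>M\<^esub> a) \<in> balanced_maps R M (regular_bimodule R) M"
    by (intro balanced_mapsI additive_mapsI)
      (simp_all add: rsmult_closed rsmult_l_distr rsmult_r_distr rsmult_assoc)
  show ?thesis
    using tensor_lift_pure[OF abelian_group_axioms b] assms by (simp add: tensor_right_unit_def)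
qed

context bimodule
begin

interpretation RM: tensor_product R "regular_bimodule R" M
  using bimodule_regular by (intro tensor_product.intro bimodule_axioms) (simp add: bimodule_def)

lemma tensor_left_unit_balanced: "(\<lambda>a m. a \<triangleright>\<^bsub>M\<^esub> m) \<in> balanced_maps R (regular_bimodule R) M M"
  by (intro balanced_mapsI additive_mapsI)
    (simp_all add: lsmult_closed lsmult_l_distr lsmult_r_distr lsmult_assoc)

lemma tensor_left_unit_additive: "tensor_left_unit M \<in> additive_maps RM.T M"
  unfolding tensor_left_unit_def
  by (rule RM.tensor_lift_additive[OF abelian_group_axioms tensor_left_unit_balanced])

lemma tensor_left_unit_pure:
  "\<lbrakk>a \<in> carrier R; m \<in> carrier M\<rbrakk> \<Longrightarrow> tensor_left_unit M (RM.pure a m) = a \<triangleright>\<^bsub>M\<^esub> m"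
  unfolding tensor_left_unit_def
  using RM.tensor_lift_pure[OF abelian_group_axioms tensor_left_unit_balanced] by simp

text \<open>On pure tensors this is \<open>1 \<otimes> a m = 1 a \<otimes> m = a \<otimes> m\<close>.\<close>

lemma pure_one_tensor_left_unit:
  assumes "t \<in> carrier RM.T"
  shows "RM.pure \<one>\<^bsub>R\<^esub> (tensor_left_unit M t) = t"
proof (rule RM.additive_maps_eqI[OF RM.tensor_group_abelian, of "\<lambda>t. RM.pure \<one>\<^bsub>R\<^esub> (tensor_left_unit M t)" "\<lambda>t. t"])
  show "(\<lambda>t. RM.pure \<one>\<^bsub>R\<^esub> (tensor_left_unit M t)) \<in> additive_maps RM.T RM.T"
    by (rule additive_maps_compose[OF tensor_left_unit_additive balanced_mapsD(1)[OF RM.pure_balanced]]) simp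
  show "(\<lambda>t. t) \<in> additive_maps RM.T RM.T" by (auto intro: additive_mapsI)
  fix a m assume "a \<in> carrier (regular_bimodule R)" "m \<in> carrier M"
  then show "RM.pure \<one>\<^bsub>R\<^esub> (tensor_left_unit M (RM.pure a m)) = RM.pure a m"
    using RM.pure_middle[of "\<one>\<^bsub>R\<^esub>" a m] tensor_left_unit_pure[of a m] by simp
qed fact

text \<open>The left unit map sends \<open>1 \<otimes> m\<close> back to \<open>m\<close>.\<close>

lemma pure_one_inj:
  assumes "m \<in> carrier M" "n \<in> carrier M" "RM.pure \<one>\<^bsub>R\<^esub> m = RM.pure \<one>\<^bsub>R\<^esub> n"
  shows "m = n"
  using assms tensor_left_unit_pure[of "\<one>\<^bsub>R\<^esub>" m] tensor_left_unit_pure[of "\<one>\<^bsub>R\<^esub>" n]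
  by (metis lsmult_one one_closed)

end


section \<open>Comodule structures on the base ring\<close>

text \<open>Both abstractions are restricted to carriers because comodule structures are taken to be
  extensional.\<close>

definition grouplike_coaction ::
    "('g, 'h) monoid_scheme \<Rightarrow> ('a, 'r) ring_scheme \<Rightarrow> ('g \<Rightarrow> ('a, 'c) bimodule) \<Rightarrow> ('g \<Rightarrow> 'c) \<Rightarrow>
      'g \<Rightarrow> 'a \<Rightarrow> ('a \<times> 'c \<Rightarrow>\<^sub>0 int) set" where
  "grouplike_coaction G A C x =
     (\<lambda>\<alpha>\<in>carrier G. \<lambda>a\<in>carrier A. pure_tensor A (regular_bimodule A) (C \<alpha>) \<one>\<^bsub>A\<^esub> (x \<alpha> \<triangleleft>\<^bsub>C \<alpha>\<^esub> a))"

context group_coring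
begin

interpretation G: group G by (rule group)
interpretation A: ring A by (rule ring)
interpretation AA: bimodule A "regular_bimodule A" by (rule A.bimodule_regular)

abbreviation (input) "A\<^sub>A \<equiv> regular_bimodule A"

lemma tensor_product_A: "\<alpha> \<in> carrier G \<Longrightarrow> tensor_product A A\<^sub>A (C \<alpha>)"
  by (intro tensor_product.intro AA.right_module_axioms bimodule)

lemma bimodule_tensor_product_C:
  "\<lbrakk>\<alpha> \<in> carrier G; \<beta> \<in> carrier G\<rbrakk> \<Longrightarrow> bimodule_tensor_product A (C \<alpha>) (C \<beta>)"
  by (intro bimodule_tensor_product.intro bimodule)

lemma triple_tensor_product_A:
  "\<lbrakk>\<alpha> \<in> carrier G; \<beta> \<in> carrier G\<rbrakk> \<Longrightarrow> triple_tensor_product A A\<^sub>A (C \<alpha>) (C \<beta>)"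
  by (intro triple_tensor_product.intro tensor_product_A bimodule_tensor_product_C)

lemma comult_right_module_hom:
  "\<lbrakk>\<alpha> \<in> carrier G; \<beta> \<in> carrier G\<rbrakk> \<Longrightarrow>
    \<Delta> \<alpha> \<beta> \<in> right_module_hom A (C (\<alpha> \<otimes>\<^bsub>G\<^esub> \<beta>)) (tensor_bimodule A (C \<alpha>) (C \<beta>))"
  by (rule bimodule_hom_imp_right[OF comult_hom])

lemma comult_closed:
  "\<lbrakk>\<alpha> \<in> carrier G; \<beta> \<in> carrier G; c \<in> carrier (C (\<alpha> \<otimes>\<^bsub>G\<^esub> \<beta>))\<rbrakk> \<Longrightarrow>
    \<Delta> \<alpha> \<beta> c \<in> carrier (tensor_group A (C \<alpha>) (C \<beta>))"
  using right_module_hom_closed[OF comult_right_module_hom] by simp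

lemma counit_right_module_hom: "\<epsilon> \<in> right_module_hom A (C \<one>\<^bsub>G\<^esub>) A\<^sub>A"
  by (rule bimodule_hom_imp_right[OF counit_hom])

text \<open>The left-hand side of the coassociativity law for \<open>\<rho>\<close>, whenever \<open>\<rho>\<^sub>\<alpha>\<^sub>\<beta>(a) = 1 \<otimes> c\<close>.\<close>

lemma comult_after_coaction:
  assumes \<alpha>: "\<alpha> \<in> carrier G" and \<beta>: "\<beta> \<in> carrier G" and c: "c \<in> carrier (C (\<alpha> \<otimes>\<^bsub>G\<^esub> \<beta>))"
  shows "tensor_map A A\<^sub>A (tensor_bimodule A (C \<alpha>) (C \<beta>)) id (\<Delta> \<alpha> \<beta>)
      (pure_tensor A A\<^sub>A (C (\<alpha> \<otimes>\<^bsub>G\<^esub> \<beta>)) \<one>\<^bsub>A\<^esub> c)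
    = pure_tensor A A\<^sub>A (tensor_bimodule A (C \<alpha>) (C \<beta>)) \<one>\<^bsub>A\<^esub> (\<Delta> \<alpha> \<beta> c)"
proof -
  interpret triple_tensor_product A A\<^sub>A "C \<alpha>" "C \<beta>" by (rule triple_tensor_product_A[OF \<alpha> \<beta>])
  show ?thesis
    using tensor_map_pure[OF tensor_product_A[OF G.m_closed[OF \<alpha> \<beta>]] right.tensor_product_axioms
        right_module_hom_id bimodule_hom_imp_left[OF comult_hom[OF \<alpha> \<beta>]], of "\<one>\<^bsub>A\<^esub>" c] c by simp
qed

text \<open>The right-hand side of the coassociativity law, whenever \<open>\<rho>\<^sub>\<beta>(a) = 1 \<otimes> d\<close>: right
  linearity of \<open>f = \<rho>\<^sub>\<alpha>\<close> makes \<open>f \<otimes> C\<^sub>\<beta>\<close> well defined, and only the value \<open>f 1 = 1 \<otimes> c\<close> enters.\<close>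

lemma coaction_after_coaction:
  assumes \<alpha>: "\<alpha> \<in> carrier G" and \<beta>: "\<beta> \<in> carrier G"
    and c: "c \<in> carrier (C \<alpha>)" and d: "d \<in> carrier (C \<beta>)"
    and f: "f \<in> right_module_hom A A\<^sub>A (tensor_right_module A A\<^sub>A (C \<alpha>))"
    and f_one: "f \<one>\<^bsub>A\<^esub> = pure_tensor A A\<^sub>A (C \<alpha>) \<one>\<^bsub>A\<^esub> c"
  shows "tensor_assoc A A\<^sub>A (C \<alpha>) (C \<beta>)
      (tensor_map A (tensor_right_module A A\<^sub>A (C \<alpha>)) (C \<beta>) f id
        (pure_tensor A A\<^sub>A (C \<beta>) \<one>\<^bsub>A\<^esub> d))
    = pure_tensor A A\<^sub>A (tensor_bimodule A (C \<alpha>) (C \<beta>)) \<one>\<^bsub>A\<^esub> (pure_tensor A (C \<alpha>) (C \<beta>) c d)"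
proof -
  interpret triple_tensor_product A A\<^sub>A "C \<alpha>" "C \<beta>" by (rule triple_tensor_product_A[OF \<alpha> \<beta>])
  show ?thesis
    using tensor_map_pure[OF tensor_product_A[OF \<beta>] left.tensor_product_axioms f left_module_hom_id,
        of "\<one>\<^bsub>A\<^esub>" d] tensor_assoc_pure[of "\<one>\<^bsub>A\<^esub>" c d] c d by (simp add: f_one)
qed

lemma counit_after_coaction:
  assumes c: "c \<in> carrier (C \<one>\<^bsub>G\<^esub>)"
  shows "tensor_right_unit A\<^sub>A (tensor_map A A\<^sub>A A\<^sub>A id \<epsilon> (pure_tensor A A\<^sub>A (C \<one>\<^bsub>G\<^esub>) \<one>\<^bsub>A\<^esub> c)) = \<epsilon> c"
proof -
  have "\<epsilon> c \<in> carrier A"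
    using right_module_hom_closed[OF counit_right_module_hom c] by simp
  moreover have "tensor_product A A\<^sub>A A\<^sub>A"
    by (intro tensor_product.intro AA.right_module_axioms AA.bimodule_axioms)
  ultimately show ?thesis
    using tensor_map_pure[OF tensor_product_A[OF G.one_closed] _ right_module_hom_id
        bimodule_hom_imp_left[OF counit_hom], of "\<one>\<^bsub>A\<^esub>" c]
      AA.tensor_right_unit_pure[of "\<one>\<^bsub>A\<^esub>" "\<epsilon> c"] c by simp
qed

lemma grouplike_coaction_hom:
  assumes \<alpha>: "\<alpha> \<in> carrier G" and c: "x \<alpha> \<in> carrier (C \<alpha>)"
  shows "grouplike_coaction G A C x \<alpha> \<in> right_module_hom A A\<^sub>A (tensor_right_module A A\<^sub>A (C \<alpha>))"
proof -
  interpret tensor_product A A\<^sub>A "C \<alpha>" by (rule tensor_product_A[OF \<alpha>])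
  show ?thesis
    using assms
    by (auto simp: right_module_hom_def grouplike_coaction_def pure_closed N.rsmult_closed
        N.rsmult_r_distr N.rsmult_assoc pure_add_right tensor_rsmult_pure)
qed

text \<open>The laws hold at \<open>1\<close> because \<open>x\<close> is grouplike. Since \<open>\<Delta>\<close> and \<open>\<epsilon>\<close> are right linear, the
  scalar \<open>a\<close> can be carried through, ending up on the last tensor factor.\<close>

lemma grouplike_coaction_comodule:
  assumes x: "x \<in> grouplike_families G A C \<Delta> \<epsilon>"
  shows "grouplike_coaction G A C x \<in> comodule_structures G A C \<Delta> \<epsilon> A\<^sub>A"
proof -
  let ?\<rho> = "grouplike_coaction G A C x"
  have xC: "x \<alpha> \<in> carrier (C \<alpha>)" if "\<alpha> \<in> carrier G" for \<alpha>
    using x that by (auto simp: grouplike_families_def)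
  have \<rho>: "?\<rho> \<alpha> a = pure_tensor A A\<^sub>A (C \<alpha>) \<one>\<^bsub>A\<^esub> (x \<alpha> \<triangleleft>\<^bsub>C \<alpha>\<^esub> a)"
    if "\<alpha> \<in> carrier G" "a \<in> carrier A" for \<alpha> a
    using that by (simp add: grouplike_coaction_def)
  have xa: "x \<alpha> \<triangleleft>\<^bsub>C \<alpha>\<^esub> a \<in> carrier (C \<alpha>)" if "\<alpha> \<in> carrier G" "a \<in> carrier A" for \<alpha> a
    using right_module.rsmult_closed[OF bimodule.axioms(1)[OF bimodule]] xC that by blast
  have x_one: "x \<alpha> \<triangleleft>\<^bsub>C \<alpha>\<^esub> \<one>\<^bsub>A\<^esub> = x \<alpha>" if "\<alpha> \<in> carrier G" for \<alpha>
    using right_module.rsmult_one[OF bimodule.axioms(1)[OF bimodule]] xC that by blast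
  have "right_comodule G A C \<Delta> \<epsilon> A\<^sub>A ?\<rho>"
  proof (intro right_comodule.intro right_comodule_axioms.intro)
    fix \<alpha> assume "\<alpha> \<in> carrier G"
    then show "?\<rho> \<alpha> \<in> right_module_hom A A\<^sub>A (tensor_right_module A A\<^sub>A (C \<alpha>))"
      by (intro grouplike_coaction_hom xC)
  next
    fix \<alpha> \<beta> a assume \<alpha>: "\<alpha> \<in> carrier G" and \<beta>: "\<beta> \<in> carrier G" and "a \<in> carrier A\<^sub>A"
    then have a: "a \<in> carrier A" by simp
    interpret CC: bimodule_tensor_product A "C \<alpha>" "C \<beta>" by (rule bimodule_tensor_product_C[OF \<alpha> \<beta>])
    have "\<Delta> \<alpha> \<beta> (x (\<alpha> \<otimes>\<^bsub>G\<^esub> \<beta>) \<triangleleft>\<^bsub>C (\<alpha> \<otimes>\<^bsub>G\<^esub> \<beta>)\<^esub> a)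
        = CC.pure (x \<alpha>) (x \<beta>) \<triangleleft>\<^bsub>tensor_bimodule A (C \<alpha>) (C \<beta>)\<^esub> a"
      using comult_right_module_hom[OF \<alpha> \<beta>] x \<alpha> \<beta> a xC[of "\<alpha> \<otimes>\<^bsub>G\<^esub> \<beta>"]
      by (simp add: right_module_hom_def grouplike_families_def)
    also have "\<dots> = CC.pure (x \<alpha>) (x \<beta> \<triangleleft>\<^bsub>C \<beta>\<^esub> a)"
      using CC.tensor_rsmult_pure \<alpha> \<beta> a xC by simp
    finally have \<Delta>: "\<Delta> \<alpha> \<beta> (x (\<alpha> \<otimes>\<^bsub>G\<^esub> \<beta>) \<triangleleft>\<^bsub>C (\<alpha> \<otimes>\<^bsub>G\<^esub> \<beta>)\<^esub> a) = CC.pure (x \<alpha>) (x \<beta> \<triangleleft>\<^bsub>C \<beta>\<^esub> a)" .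
    have "tensor_map A A\<^sub>A (tensor_bimodule A (C \<alpha>) (C \<beta>)) id (\<Delta> \<alpha> \<beta>) (?\<rho> (\<alpha> \<otimes>\<^bsub>G\<^esub> \<beta>) a)
        = pure_tensor A A\<^sub>A (tensor_bimodule A (C \<alpha>) (C \<beta>)) \<one>\<^bsub>A\<^esub> (CC.pure (x \<alpha>) (x \<beta> \<triangleleft>\<^bsub>C \<beta>\<^esub> a))"
      using \<alpha> \<beta> a by (simp add: \<rho> comult_after_coaction xa \<Delta>)
    also have "\<dots> = tensor_assoc A A\<^sub>A (C \<alpha>) (C \<beta>)
        (tensor_map A (tensor_right_module A A\<^sub>A (C \<alpha>)) (C \<beta>) (?\<rho> \<alpha>) id (?\<rho> \<beta> a))"
      using coaction_after_coaction[OF \<alpha> \<beta> xC[OF \<alpha>] xa[OF \<beta> a] grouplike_coaction_hom[OF \<alpha>, of x, OF xC[OF \<alpha>]]]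
        \<alpha> \<beta> a by (simp add: \<rho> x_one)
    finally show "tensor_map A A\<^sub>A (tensor_bimodule A (C \<alpha>) (C \<beta>)) id (\<Delta> \<alpha> \<beta>) (?\<rho> (\<alpha> \<otimes>\<^bsub>G\<^esub> \<beta>) a)
        = tensor_assoc A A\<^sub>A (C \<alpha>) (C \<beta>)
          (tensor_map A (tensor_right_module A A\<^sub>A (C \<alpha>)) (C \<beta>) (?\<rho> \<alpha>) id (?\<rho> \<beta> a))" .
  next
    fix a assume "a \<in> carrier A\<^sub>A"
    then have a: "a \<in> carrier A" by simp
    have "\<epsilon> (x \<one>\<^bsub>G\<^esub> \<triangleleft>\<^bsub>C \<one>\<^bsub>G\<^esub>\<^esub> a) = a"
      using counit_right_module_hom x a xC[of "\<one>\<^bsub>G\<^esub>"]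
      by (simp add: right_module_hom_def grouplike_families_def)
    then show "tensor_right_unit A\<^sub>A (tensor_map A A\<^sub>A A\<^sub>A id \<epsilon> (?\<rho> \<one>\<^bsub>G\<^esub> a)) = a"
      using a by (simp add: \<rho> counit_after_coaction xa)
  qed (rule group_coring_axioms AA.right_module_axioms)+
  moreover have "?\<rho> \<in> (\<Pi>\<^sub>E \<alpha>\<in>carrier G. carrier A\<^sub>A \<rightarrow>\<^sub>E carrier (tensor_right_module A A\<^sub>A (C \<alpha>)))"
    using right_module_hom_closed[OF grouplike_coaction_hom] xC
    by (auto simp: grouplike_coaction_def)
  ultimately show ?thesis by (simp add: comodule_structures_def)
qed

text \<open>Right linearity forces \<open>\<rho>\<^sub>\<alpha>(a) = \<rho>\<^sub>\<alpha>(1) a\<close>, and evaluating the comodule laws at \<open>1\<close>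
  yields the grouplike conditions.\<close>

lemma comodule_grouplike:
  assumes \<rho>: "\<rho> \<in> comodule_structures G A C \<Delta> \<epsilon> A\<^sub>A"
  shows "\<exists>x\<in>grouplike_families G A C \<Delta> \<epsilon>. \<rho> = grouplike_coaction G A C x"
proof -
  interpret right_comodule G A C \<Delta> \<epsilon> A\<^sub>A \<rho>
    using \<rho> by (simp add: comodule_structures_def)
  \<comment> \<open>The unique \<open>x\<^sub>\<alpha>\<close> with \<open>\<rho>\<^sub>\<alpha>(1) = 1 \<otimes> x\<^sub>\<alpha>\<close>.\<close>
  define x where "x = (\<lambda>\<alpha>\<in>carrier G. tensor_left_unit (C \<alpha>) (\<rho> \<alpha> \<one>\<^bsub>A\<^esub>))"
  have \<rho>_closed: "\<rho> \<alpha> a \<in> carrier (tensor_group A A\<^sub>A (C \<alpha>))" if "\<alpha> \<in> carrier G" "a \<in> carrier A" for \<alpha> a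
    using right_module_hom_closed[OF coaction_hom[OF that(1)], of a] that(2) by simp
  have xC: "x \<alpha> \<in> carrier (C \<alpha>)" if \<alpha>: "\<alpha> \<in> carrier G" for \<alpha>
    using additive_maps_closed[OF bimodule.tensor_left_unit_additive[OF bimodule[OF \<alpha>]] \<rho>_closed[OF \<alpha>]]
      \<alpha> by (simp add: x_def)
  have \<rho>_one: "\<rho> \<alpha> \<one>\<^bsub>A\<^esub> = pure_tensor A A\<^sub>A (C \<alpha>) \<one>\<^bsub>A\<^esub> (x \<alpha>)" if \<alpha>: "\<alpha> \<in> carrier G" for \<alpha>
    using bimodule.pure_one_tensor_left_unit[OF bimodule[OF \<alpha>] \<rho>_closed[OF \<alpha>]] \<alpha> by (simp add: x_def)
  have \<rho>_eq: "\<rho> \<alpha> a = pure_tensor A A\<^sub>A (C \<alpha>) \<one>\<^bsub>A\<^esub> (x \<alpha> \<triangleleft>\<^bsub>C \<alpha>\<^esub> a)"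
    if \<alpha>: "\<alpha> \<in> carrier G" and a: "a \<in> carrier A" for \<alpha> a
  proof -
    interpret tensor_product A A\<^sub>A "C \<alpha>" by (rule tensor_product_A[OF \<alpha>])
    have "\<rho> \<alpha> (\<one>\<^bsub>A\<^esub> \<otimes>\<^bsub>A\<^esub> a) = \<rho> \<alpha> \<one>\<^bsub>A\<^esub> \<triangleleft>\<^bsub>tensor_right_module A A\<^sub>A (C \<alpha>)\<^esub> a"
      using coaction_hom[OF \<alpha>] a A.one_closed
      unfolding right_module_hom_def regular_bimodule_simps by blast
    then show ?thesis
      using \<alpha> a xC by (simp add: \<rho>_one tensor_rsmult_pure)
  qed
  have "\<rho> = grouplike_coaction G A C x"
  proof -
    have \<rho>_ext: "\<rho> \<in> (\<Pi>\<^sub>E \<alpha>\<in>carrier G. carrier A\<^sub>A \<rightarrow>\<^sub>E carrier (tensor_right_module A A\<^sub>A (C \<alpha>)))"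
      using \<rho> by (simp add: comodule_structures_def)
    show ?thesis
    proof (intro ext)
      fix \<alpha> a show "\<rho> \<alpha> a = grouplike_coaction G A C x \<alpha> a"
        using \<rho>_ext \<rho>_eq by (cases "\<alpha> \<in> carrier G"; cases "a \<in> carrier A")
          (auto simp: grouplike_coaction_def PiE_def Pi_def extensional_def)
    qed
  qed
  moreover have "x \<in> grouplike_families G A C \<Delta> \<epsilon>"
    unfolding grouplike_families_def
  proof (intro CollectI conjI ballI)
    show "x \<in> (\<Pi>\<^sub>E \<alpha>\<in>carrier G. carrier (C \<alpha>))"
      using xC by (auto simp: x_def)
    show "\<epsilon> (x \<one>\<^bsub>G\<^esub>) = \<one>\<^bsub>A\<^esub>"
      using coaction_counit[of "\<one>\<^bsub>A\<^esub>"] counit_after_coaction[OF xC] by (simp add: \<rho>_one)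
    fix \<alpha> \<beta> assume \<alpha>: "\<alpha> \<in> carrier G" and \<beta>: "\<beta> \<in> carrier G"
    interpret CC: bimodule_tensor_product A "C \<alpha>" "C \<beta>" by (rule bimodule_tensor_product_C[OF \<alpha> \<beta>])
    have "pure_tensor A A\<^sub>A (tensor_bimodule A (C \<alpha>) (C \<beta>)) \<one>\<^bsub>A\<^esub> (\<Delta> \<alpha> \<beta> (x (\<alpha> \<otimes>\<^bsub>G\<^esub> \<beta>)))
      = pure_tensor A A\<^sub>A (tensor_bimodule A (C \<alpha>) (C \<beta>)) \<one>\<^bsub>A\<^esub> (CC.pure (x \<alpha>) (x \<beta>))"
      using coaction_coassoc[OF \<alpha> \<beta>, of "\<one>\<^bsub>A\<^esub>"] \<alpha> \<beta>
        coaction_after_coaction[OF \<alpha> \<beta> xC[OF \<alpha>] xC[OF \<beta>] coaction_hom[OF \<alpha>] \<rho>_one[OF \<alpha>]]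
      by (simp add: \<rho>_one comult_after_coaction xC)
    \<comment> \<open>The factor \<open>1 \<otimes>\<close> cancels over the bimodule \<open>C\<^sub>\<alpha> \<otimes> C\<^sub>\<beta>\<close>.\<close>
    then show "\<Delta> \<alpha> \<beta> (x (\<alpha> \<otimes>\<^bsub>G\<^esub> \<beta>)) = CC.pure (x \<alpha>) (x \<beta>)"
      using bimodule.pure_one_inj[OF CC.bimodule_tensor] \<alpha> \<beta> by (simp add: comult_closed xC CC.pure_closed)
  qed
  ultimately show ?thesis by blast
qed

lemma grouplike_coaction_inj: "inj_on (grouplike_coaction G A C) (grouplike_families G A C \<Delta> \<epsilon>)"
proof (rule inj_onI)
  fix x y assume x: "x \<in> grouplike_families G A C \<Delta> \<epsilon>" and y: "y \<in> grouplike_families G A C \<Delta> \<epsilon>"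
    and eq: "grouplike_coaction G A C x = grouplike_coaction G A C y"
  have "x \<in> (\<Pi>\<^sub>E \<alpha>\<in>carrier G. carrier (C \<alpha>))" "y \<in> (\<Pi>\<^sub>E \<alpha>\<in>carrier G. carrier (C \<alpha>))"
    using x y by (simp_all add: grouplike_families_def)
  then show "x = y"
  proof (rule PiE_ext)
    fix \<alpha> assume \<alpha>: "\<alpha> \<in> carrier G"
    interpret bimodule A "C \<alpha>" by (rule bimodule[OF \<alpha>])
    have "x \<alpha> \<in> carrier (C \<alpha>)" "y \<alpha> \<in> carrier (C \<alpha>)"
      using x y \<alpha> by (auto simp: grouplike_families_def)
    then show "x \<alpha> = y \<alpha>"
      using fun_cong[OF fun_cong[OF eq, of \<alpha>], of "\<one>\<^bsub>A\<^esub>"] \<alpha> pure_one_inj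
      by (simp add: grouplike_coaction_def rsmult_one)
  qed
qed

end


theorem proposition5p1:
  fixes G :: "('g, 'h) monoid_scheme"
    and A :: "('a, 'r) ring_scheme"
    and C :: "'g \<Rightarrow> ('a, 'c) bimodule"
    and \<Delta> :: "'g \<Rightarrow> 'g \<Rightarrow> 'c \<Rightarrow> ('c \<times> 'c \<Rightarrow>\<^sub>0 int) set"
    and \<epsilon> :: "'c \<Rightarrow> 'a"
  assumes "group_coring G A C \<Delta> \<epsilon>"
  shows "\<exists>\<Phi>. bij_betw \<Phi> (grouplike_families G A C \<Delta> \<epsilon>)
                (comodule_structures G A C \<Delta> \<epsilon> (regular_bimodule A)) \<and>
           (\<forall>x\<in>grouplike_families G A C \<Delta> \<epsilon>. \<forall>\<alpha>\<in>carrier G. \<forall>a\<in>carrier A.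
              \<Phi> x \<alpha> a = pure_tensor A (regular_bimodule A) (C \<alpha>) \<one>\<^bsub>A\<^esub> (x \<alpha> \<triangleleft>\<^bsub>C \<alpha>\<^esub> a))"
proof -
  interpret group_coring G A C \<Delta> \<epsilon> by fact
  have "bij_betw (grouplike_coaction G A C) (grouplike_families G A C \<Delta> \<epsilon>)
      (comodule_structures G A C \<Delta> \<epsilon> (regular_bimodule A))"
    using grouplike_coaction_inj grouplike_coaction_comodule comodule_grouplike
    by (fastforce simp: bij_betw_def)
  moreover have "\<forall>x\<in>grouplike_families G A C \<Delta> \<epsilon>. \<forall>\<alpha>\<in>carrier G. \<forall>a\<in>carrier A.
      grouplike_coaction G A C x \<alpha> a
        = pure_tensor A (regular_bimodule A) (C \<alpha>) \<one>\<^bsub>A\<^esub> (x \<alpha> \<triangleleft>\<^bsub>C \<alpha>\<^esub> a)"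
    by (simp add: grouplike_coaction_def)
  ultimately show ?thesis by blast
qed

end
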